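(* Let $G=(V_G,E_G)$ be a simple graph with $V_G=\{1,\dots,n\}$ and $|E_G|\geq 2$, and let $\mathbb{K}$ be a field. If $G$ is bipartite, then $\operatorname{d}(I(G))=2$ if and only if $G$ is bipartite chordal.
   Context: $\mathbb{K}[E_G]=\mathbb{K}[t_e: e\in E_G]$ is the (standard graded) polynomial ring with one variable for each edge of $G$. Eulerian ideal: let $\varphi:\mathbb{K}[E_G]\to\mathbb{K}[x_1,\dots,x_n]$ be the $\mathbb{K}$-algebra homomorphism with $t_e\mapsto x_ix_j$ for every edge $e=\{i,j\}$. Then $I(G)=\varphi^{-1}\bigl((x_i^2-x_j^2 : i,j\in V_G)\bigr)$, a homogeneous ideal. $\operatorname{d}(I(G))$ denotes the maximal generating degree of $I(G)$, i.e. the maximum degree of an element of a minimal homogeneous generating set of $I(G)$. A chord of a cycle is an edge of $G$ joining two vertices of the cycle that are nonadjacent in the cycle. A bipartite graph is bipartite chordal if every cycle of length greater than $4$ has a chord. *)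

theory Defs
  imports "HOL-Algebra.Ideal" "HOL-Algebra.Ring" "HOL-Library.Poly_Mapping"
begin

section \<open>Polynomial rings in a given set of variables\<close>

text \<open>Monomials are finitely supported exponent vectors, and polynomials are finitely supported
  families of coefficients indexed by monomials; \<^term>\<open>mpoly_ring V\<close> is the polynomial ring
  whose variables are the elements of \<^term>\<open>V\<close>.\<close>

type_synonym ('v, 'k) mpoly = "('v \<Rightarrow>\<^sub>0 nat) \<Rightarrow>\<^sub>0 'k"

definition mpoly_ring :: "'v set \<Rightarrow> ('v, 'k::comm_ring_1) mpoly ring" where
  "mpoly_ring V = \<lparr>carrier = {p. \<forall>m\<in>Poly_Mapping.keys p. Poly_Mapping.keys m \<subseteq> V},
     monoid.mult = (*), one = 1, zero = 0, add = (+)\<rparr>"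

definition mvar :: "'v \<Rightarrow> ('v, 'k::comm_ring_1) mpoly" where
  "mvar v = Poly_Mapping.single (Poly_Mapping.single v 1) 1"

definition mconst :: "'k \<Rightarrow> ('v, 'k::comm_ring_1) mpoly" where
  "mconst c = Poly_Mapping.single 0 c"

definition mpoly_subst ::
  "('v \<Rightarrow> ('w, 'k::comm_ring_1) mpoly) \<Rightarrow> ('v, 'k) mpoly \<Rightarrow> ('w, 'k) mpoly" where
  "mpoly_subst f p = (\<Sum>m\<in>Poly_Mapping.keys p. mconst (Poly_Mapping.lookup p m) *
     (\<Prod>v\<in>Poly_Mapping.keys m. f v ^ Poly_Mapping.lookup m v))"

definition monom_degree :: "('v \<Rightarrow>\<^sub>0 nat) \<Rightarrow> nat" where
  "monom_degree m = (\<Sum>v\<in>Poly_Mapping.keys m. Poly_Mapping.lookup m v)"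

definition mpoly_degree :: "('v, 'k::comm_ring_1) mpoly \<Rightarrow> nat" where
  "mpoly_degree p = Max (insert 0 (monom_degree ` Poly_Mapping.keys p))"

definition mpoly_homogeneous :: "('v, 'k::comm_ring_1) mpoly \<Rightarrow> bool" where
  "mpoly_homogeneous p \<longleftrightarrow> (\<exists>d. \<forall>m\<in>Poly_Mapping.keys p. monom_degree m = d)"

lemma mpoly_ring_simps [simp]:
  "x \<otimes>\<^bsub>mpoly_ring V\<^esub> y = x * y" "x \<oplus>\<^bsub>mpoly_ring V\<^esub> y = x + y"
  "\<one>\<^bsub>mpoly_ring V\<^esub> = 1" "\<zero>\<^bsub>mpoly_ring V\<^esub> = 0"
  by (simp_all add: mpoly_ring_def)

lemma mem_carrier_mpoly_ring:
  "p \<in> carrier (mpoly_ring V) \<longleftrightarrow> (\<forall>m\<in>Poly_Mapping.keys p. Poly_Mapping.keys m \<subseteq> V)"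
  by (simp add: mpoly_ring_def)

lemma mpoly_ring_add_closed:
  "p \<in> carrier (mpoly_ring V) \<Longrightarrow> q \<in> carrier (mpoly_ring V) \<Longrightarrow> p + q \<in> carrier (mpoly_ring V)"
  using Poly_Mapping.keys_add[of p q] by (fastforce simp: mem_carrier_mpoly_ring)

lemma mpoly_ring_mult_closed:
  assumes "p \<in> carrier (mpoly_ring V)" "q \<in> carrier (mpoly_ring V)"
  shows "p * q \<in> carrier (mpoly_ring V)"
  unfolding mem_carrier_mpoly_ring
proof
  fix m assume "m \<in> Poly_Mapping.keys (p * q)"
  then obtain a b where "a \<in> Poly_Mapping.keys p" "b \<in> Poly_Mapping.keys q" "m = a + b"
    using keys_mult[of p q] by blast
  then show "Poly_Mapping.keys m \<subseteq> V"
    using assms Poly_Mapping.keys_add[of a b] by (force simp: mem_carrier_mpoly_ring)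
qed

lemma mpoly_ring_one_closed: "1 \<in> carrier (mpoly_ring V)"
  by (simp add: mem_carrier_mpoly_ring)

lemma mpoly_ring_cring: "cring (mpoly_ring V :: ('v, 'k::comm_ring_1) mpoly ring)"
proof (rule cringI)
  show "abelian_group (mpoly_ring V :: ('v, 'k) mpoly ring)"
  proof (rule abelian_groupI)
    fix x :: "('v, 'k) mpoly" assume "x \<in> carrier (mpoly_ring V)"
    then show "\<exists>y\<in>carrier (mpoly_ring V). y \<oplus>\<^bsub>mpoly_ring V\<^esub> x = \<zero>\<^bsub>mpoly_ring V\<^esub>"
      by (intro bexI[of _ "- x"]) (auto simp: mem_carrier_mpoly_ring)
  qed (auto simp: mpoly_ring_add_closed add.assoc add.commute, simp add: mem_carrier_mpoly_ring)
  show "Group.comm_monoid (mpoly_ring V :: ('v, 'k) mpoly ring)"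
    by (rule comm_monoidI)
      (auto simp: mpoly_ring_mult_closed mpoly_ring_one_closed mult.assoc mult.commute)
qed (simp add: distrib_right)

lemma mpoly_subst_superset:
  assumes "finite A" "Poly_Mapping.keys p \<subseteq> A"
  shows "mpoly_subst f p = (\<Sum>m\<in>A. mconst (Poly_Mapping.lookup p m) *
     (\<Prod>v\<in>Poly_Mapping.keys m. f v ^ Poly_Mapping.lookup m v))"
  unfolding mpoly_subst_def
  by (rule sum.mono_neutral_left) (use assms in \<open>auto simp: mconst_def in_keys_iff\<close>)

lemma mpoly_subst_zero [simp]: "mpoly_subst f 0 = 0"
  by (simp add: mpoly_subst_def)

lemma mpoly_subst_one [simp]: "mpoly_subst f 1 = 1"
  by (simp add: mpoly_subst_def mconst_def)

lemma mpoly_subst_var [simp]: "mpoly_subst f (mvar v) = f v"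
  by (simp add: mpoly_subst_def mvar_def mconst_def)

lemma mpoly_subst_const [simp]: "mpoly_subst f (mconst c) = mconst c"
  by (simp add: mpoly_subst_def mconst_def)

lemma mpoly_subst_add: "mpoly_subst f (p + q) = mpoly_subst f p + mpoly_subst f q"
proof -
  let ?A = "Poly_Mapping.keys p \<union> Poly_Mapping.keys q"
  have "Poly_Mapping.keys (p + q) \<subseteq> ?A" by (rule Poly_Mapping.keys_add)
  then show ?thesis
    by (simp add: mpoly_subst_superset[of ?A] lookup_add mconst_def single_add distrib_right
        sum.distrib)
qed

lemma mpoly_subst_sum: "mpoly_subst f (sum g A) = (\<Sum>a\<in>A. mpoly_subst f (g a))"
  by (induction A rule: infinite_finite_induct) (auto simp: mpoly_subst_add)

lemma prod_power_add:
  fixes f :: "'v \<Rightarrow> 'a::comm_monoid_mult"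
  shows "(\<Prod>v\<in>Poly_Mapping.keys (a + b). f v ^ Poly_Mapping.lookup (a + b) v) =
    (\<Prod>v\<in>Poly_Mapping.keys a. f v ^ Poly_Mapping.lookup a v) *
    (\<Prod>v\<in>Poly_Mapping.keys b. f v ^ Poly_Mapping.lookup b v)"
proof -
  let ?A = "Poly_Mapping.keys a \<union> Poly_Mapping.keys b"
  have *: "(\<Prod>v\<in>Poly_Mapping.keys c. f v ^ Poly_Mapping.lookup c v) =
      (\<Prod>v\<in>?A. f v ^ Poly_Mapping.lookup c v)" if "Poly_Mapping.keys c \<subseteq> ?A" for c
    by (rule prod.mono_neutral_left) (use that in \<open>auto simp: in_keys_iff\<close>)
  show ?thesis
    unfolding *[OF Poly_Mapping.keys_add] *[OF Un_upper1] *[OF Un_upper2]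
    by (simp add: lookup_add power_add prod.distrib)
qed

lemma mpoly_subst_single:
  "mpoly_subst f (Poly_Mapping.single m c) =
    mconst c * (\<Prod>v\<in>Poly_Mapping.keys m. f v ^ Poly_Mapping.lookup m v)"
  by (simp add: mpoly_subst_def mconst_def)

lemma mpoly_as_sum:
  "p = (\<Sum>m\<in>Poly_Mapping.keys p. Poly_Mapping.single m (Poly_Mapping.lookup p m))"
  by (rule poly_mapping_eqI)
    (simp add: lookup_sum lookup_single when_def in_keys_iff sum.delta')

lemma mpoly_subst_mult:
  fixes f :: "'v \<Rightarrow> ('w, 'k::comm_ring_1) mpoly"
  shows "mpoly_subst f (p * q) = mpoly_subst f p * mpoly_subst f q"
proof -
  have *: "mpoly_subst f (Poly_Mapping.single a c * Poly_Mapping.single b d) =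
      mpoly_subst f (Poly_Mapping.single a c) * mpoly_subst f (Poly_Mapping.single b d)" for a b c d
  proof -
    have "mconst (c * d) = (mconst c * mconst d :: ('w, 'k) mpoly)"
      by (simp add: mconst_def mult_single)
    then show ?thesis
      by (simp add: mult_single mpoly_subst_single prod_power_add mult_ac)
  qed
  have "p * q = (\<Sum>a\<in>Poly_Mapping.keys p. \<Sum>b\<in>Poly_Mapping.keys q.
      Poly_Mapping.single a (Poly_Mapping.lookup p a) * Poly_Mapping.single b (Poly_Mapping.lookup q b))"
    by (simp only: sum_product[symmetric] mpoly_as_sum[symmetric])
  then have "mpoly_subst f (p * q) =
      mpoly_subst f (\<Sum>a\<in>Poly_Mapping.keys p. Poly_Mapping.single a (Poly_Mapping.lookup p a)) *
      mpoly_subst f (\<Sum>b\<in>Poly_Mapping.keys q. Poly_Mapping.single b (Poly_Mapping.lookup q b))"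
    by (simp only: mpoly_subst_sum * sum_product)
  then show ?thesis
    by (simp only: mpoly_as_sum[symmetric])
qed


section \<open>Generating degrees\<close>

definition minimal_homogeneous_generators ::
  "'v set \<Rightarrow> ('v, 'k::comm_ring_1) mpoly set \<Rightarrow> ('v, 'k) mpoly set \<Rightarrow> bool" where
  "minimal_homogeneous_generators V I S \<longleftrightarrow>
     S \<subseteq> carrier (mpoly_ring V) \<and> (\<forall>f\<in>S. mpoly_homogeneous f) \<and>
     genideal (mpoly_ring V) S = I \<and> (\<forall>T. T \<subset> S \<longrightarrow> genideal (mpoly_ring V) T \<noteq> I)"

text \<open>By the graded Nakayama lemma the value below does not depend on the choice of \<open>S\<close>; it is
  left unspecified for the zero ideal, whose minimal generating set is empty.\<close>

definition max_generating_degree :: "'v set \<Rightarrow> ('v, 'k::comm_ring_1) mpoly set \<Rightarrow> nat" where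
  "max_generating_degree V I =
     (THE d. \<exists>S. minimal_homogeneous_generators V I S \<and>
        (\<exists>f\<in>S. mpoly_degree f = d) \<and> (\<forall>f\<in>S. mpoly_degree f \<le> d))"


section \<open>Graphs\<close>

definition simple_graph :: "'a set \<Rightarrow> 'a set set \<Rightarrow> bool" where
  "simple_graph V E \<longleftrightarrow> finite V \<and> (\<forall>e\<in>E. e \<subseteq> V \<and> card e = 2)"

definition bipartite :: "'a set \<Rightarrow> 'a set set \<Rightarrow> bool" where
  "bipartite V E \<longleftrightarrow> (\<exists>A B. A \<union> B = V \<and> A \<inter> B = {} \<and> (\<forall>e\<in>E. \<exists>a\<in>A. \<exists>b\<in>B. e = {a, b}))"

text \<open>A cycle is given by the list of its vertices, without repeating the first one at the end.\<close>

definition cycle_edges :: "'a list \<Rightarrow> 'a set set" where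
  "cycle_edges c = {{c ! i, c ! (Suc i mod length c)} | i. i < length c}"

definition is_cycle :: "'a set set \<Rightarrow> 'a list \<Rightarrow> bool" where
  "is_cycle E c \<longleftrightarrow> 3 \<le> length c \<and> distinct c \<and> cycle_edges c \<subseteq> E"

definition is_chord :: "'a set set \<Rightarrow> 'a list \<Rightarrow> 'a set \<Rightarrow> bool" where
  "is_chord E c e \<longleftrightarrow> e \<in> E \<and> e \<subseteq> set c \<and> e \<notin> cycle_edges c"

definition bipartite_chordal :: "'a set \<Rightarrow> 'a set set \<Rightarrow> bool" where
  "bipartite_chordal V E \<longleftrightarrow>
     bipartite V E \<and> (\<forall>c. is_cycle E c \<and> length c > 4 \<longrightarrow> (\<exists>e. is_chord E c e))"


section \<open>The Eulerian ideal\<close>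

text \<open>The variable \<open>t\<^sub>e\<close> of the edge ring is indexed by the edge \<open>e = {i, j}\<close> itself, and is mapped
  to the product \<open>x\<^sub>i x\<^sub>j\<close> over the two endpoints.\<close>

definition edge_hom :: "('a set, 'k::field) mpoly \<Rightarrow> ('a, 'k) mpoly" where
  "edge_hom = mpoly_subst (\<lambda>e. \<Prod>i\<in>e. mvar i)"

definition eulerian_ideal :: "'a set \<Rightarrow> 'a set set \<Rightarrow> ('a set, 'k::field) mpoly set" where
  "eulerian_ideal V E = {p \<in> carrier (mpoly_ring E).
     edge_hom p \<in> genideal (mpoly_ring V) {mvar i ^ 2 - mvar j ^ 2 | i j. i \<in> V \<and> j \<in> V}}"

lemma edge_hom_var: "i \<noteq> j \<Longrightarrow> edge_hom (mvar {i, j}) = mvar i * mvar j"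
  by (simp add: edge_hom_def)

lemma mvar_closed: "v \<in> V \<Longrightarrow> mvar v \<in> carrier (mpoly_ring V)"
  by (auto simp: mvar_def mem_carrier_mpoly_ring)

lemma mpoly_subst_closed:
  fixes f :: "'v \<Rightarrow> ('w, 'k::comm_ring_1) mpoly"
  assumes "p \<in> carrier (mpoly_ring E)" and f: "\<And>e. e \<in> E \<Longrightarrow> f e \<in> carrier (mpoly_ring V)"
  shows "mpoly_subst f p \<in> carrier (mpoly_ring V)"
proof -
  have pow: "q ^ k \<in> carrier (mpoly_ring V)"
    if "q \<in> carrier (mpoly_ring V)" for q :: "('w, 'k) mpoly" and k
    using that by (induction k) (auto simp: mpoly_ring_mult_closed mpoly_ring_one_closed)
  have pr: "(\<Prod>v\<in>A. g v) \<in> carrier (mpoly_ring V)"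
    if "\<And>v. v \<in> A \<Longrightarrow> g v \<in> carrier (mpoly_ring V)" for A and g :: "'v \<Rightarrow> ('w, 'k) mpoly"
    using that
    by (induction A rule: infinite_finite_induct)
      (auto simp: mpoly_ring_mult_closed mpoly_ring_one_closed)
  have sm: "(\<Sum>v\<in>A. g v) \<in> carrier (mpoly_ring V)"
    if "\<And>v. v \<in> A \<Longrightarrow> g v \<in> carrier (mpoly_ring V)"
    for A and g :: "('v \<Rightarrow>\<^sub>0 nat) \<Rightarrow> ('w, 'k) mpoly"
    using that
    by (induction A rule: infinite_finite_induct)
      (auto simp: mpoly_ring_add_closed, simp_all add: mem_carrier_mpoly_ring)
  have "mconst c \<in> carrier (mpoly_ring V :: ('w, 'k) mpoly ring)" for c
    by (auto simp: mconst_def mem_carrier_mpoly_ring)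
  then show ?thesis
    unfolding mpoly_subst_def
    using assms(1)
    by (intro sm mpoly_ring_mult_closed pr pow f) (auto simp: mem_carrier_mpoly_ring)
qed

lemma edge_hom_ring_hom:
  assumes "simple_graph V E"
  shows "(edge_hom :: ('a set, 'k::field) mpoly \<Rightarrow> _) \<in> ring_hom (mpoly_ring E) (mpoly_ring V)"
proof (rule ring_hom_memI)
  fix p :: "('a set, 'k) mpoly" assume p: "p \<in> carrier (mpoly_ring E)"
  have "(\<Prod>i\<in>e. mvar i :: ('a, 'k) mpoly) \<in> carrier (mpoly_ring V)" if "e \<in> E" for e
  proof -
    have "e \<subseteq> V" "card e = 2"
      using that assms by (auto simp: simple_graph_def)
    moreover obtain i j where "e = {i, j}" "i \<noteq> j"
      using \<open>card e = 2\<close> by (auto simp: card_2_iff)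
    ultimately show ?thesis
      by (simp add: mpoly_ring_mult_closed mvar_closed)
  qed
  then show "edge_hom p \<in> carrier (mpoly_ring V)"
    unfolding edge_hom_def by (intro mpoly_subst_closed[OF p])
qed (simp_all add: edge_hom_def mpoly_subst_add mpoly_subst_mult)

end

theory Submission
  imports Defs
begin

text \<open>
  Modulo the polynomials \<open>x\<^sub>i\<^sup>2 - x\<^sub>j\<^sup>2\<close> two monomials become equal exactly when they have the same
  total degree and the same exponents modulo 2. Hence \<open>I(G)\<close> consists of the polynomials whose
  coefficients add up to 0 over each class of edge monomials \<open>t\<^sup>a\<close> with equal degree and equal
  parities of the vertex degrees of \<open>a\<close>; it is spanned by the binomials \<open>t\<^sup>a - t\<^sup>b\<close> with \<open>a\<close> and \<open>b\<close>
  in one class (\<open>eulerian_equiv_binomial\<close>, \<open>eulerian_ideal_least\<close>). For disjoint edge sets \<open>A\<close>,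
  \<open>B\<close> of the same size the squarefree monomials of \<open>A\<close> and \<open>B\<close> are in one class exactly when every
  vertex has even degree in \<open>A \<union> B\<close>. No two distinct monomials of degree at most 1 are in one class,
  so the question is whether every class is connected by quadratic moves: replacing \<open>t\<^sub>e\<^sup>2\<close> by \<open>t\<^sub>f\<^sup>2\<close>,
  or two edges of a 4-cycle by the other two.

  Let \<open>G\<close> be bipartite chordal, and let \<open>a\<close> and \<open>b\<close> be in one class. By induction on the degree it is
  enough to reach monomials with a common edge, which can then be cancelled
  (\<open>related_if_common_edge\<close>). A square in one of them can be moved onto any edge of the other. If both
  are squarefree, with disjoint supports \<open>A\<close> and \<open>B\<close>, then some cycle \<open>D\<close> in \<open>A \<union> B\<close> has at least half
  of its edges in \<open>A\<close>, and its length is even since \<open>G\<close> is bipartite. If the length of \<open>D\<close> is less than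
  twice the degree, the induction hypothesis exchanges half of \<open>D\<close> for the other half, which produces
  a common edge or a square. Otherwise \<open>D = A \<union> B\<close>, and in degree above 2 it has a chord that splits
  it into two shorter cycles; one of these has at least half of its edges in \<open>A\<close>, the other one in \<open>B\<close>,
  so that both monomials can be moved onto the chord (\<open>related_if_bipartite_chordal\<close>).

  Conversely, let \<open>c\<close> be a chordless cycle of length greater than 4, and let \<open>A\<close> and \<open>B\<close> be its two
  sets of alternate edges. Then \<open>t\<^sup>A - t\<^sup>B\<close> is in \<open>I(G)\<close>, but every monomial of degree at most 2
  dividing \<open>t\<^sup>A\<close> is alone in its class. So the elements of \<open>I(G)\<close> of degree at most 2 lie in the monomial
  ideal spanned by the monomials not dividing \<open>t\<^sup>A\<close>, to which \<open>t\<^sup>A - t\<^sup>B\<close> does not belong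
  (\<open>chordless_cycle_not_generated_by_quadrics\<close>).

  To pass from these two facts to the maximal generating degree, which is given by a definite
  description, two more are needed: all minimal homogeneous generating sets have the same maximal
  degree (\<open>generating_degree_le\<close>), and there is one for every graph with at least two edges. The latter
  holds because a monomial of degree greater than \<open>|E|\<close> contains a square, so that \<open>I(G)\<close> is generated
  by its finitely many binomials of degree at most \<open>|E|\<close> (\<open>related_if_card_le\<close>).
\<close>

abbreviation keys :: "('b \<Rightarrow>\<^sub>0 'c::zero) \<Rightarrow> 'b set" where
  "keys \<equiv> Poly_Mapping.keys"

abbreviation lookup :: "('b \<Rightarrow>\<^sub>0 'c::zero) \<Rightarrow> 'b \<Rightarrow> 'c" where
  "lookup \<equiv> Poly_Mapping.lookup"

abbreviation single :: "'b \<Rightarrow> 'c \<Rightarrow> ('b \<Rightarrow>\<^sub>0 'c::zero)" where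
  "single \<equiv> Poly_Mapping.single"

section \<open>Monomials\<close>

lemma keys_add_nat: "keys (a + b) = keys a \<union> keys (b :: 'v \<Rightarrow>\<^sub>0 nat)"
  by (auto simp: in_keys_iff lookup_add)

lemma single_plus_minus: "k \<le> lookup a v \<Longrightarrow> single v k + (a - single v k) = (a :: 'v \<Rightarrow>\<^sub>0 nat)"
  by (rule poly_mapping_eqI) (auto simp: lookup_add lookup_minus lookup_single when_def)

lemma keys_minus_nat: "keys (a - b) \<subseteq> keys (a :: 'v \<Rightarrow>\<^sub>0 nat)"
  by (auto simp: in_keys_iff lookup_minus)

lemma monom_degree_superset:
  "finite A \<Longrightarrow> keys m \<subseteq> A \<Longrightarrow> monom_degree m = (\<Sum>v\<in>A. lookup m v)"
  unfolding monom_degree_def by (rule sum.mono_neutral_left) (auto simp: in_keys_iff)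

lemma monom_degree_add: "monom_degree (a + b) = monom_degree a + monom_degree b"
proof -
  have "finite (keys a \<union> keys b)" by simp
  then show ?thesis
    by (simp add: monom_degree_superset[of "keys a \<union> keys b"] keys_add_nat lookup_add sum.distrib)
qed

lemma monom_degree_zero [simp]: "monom_degree 0 = 0"
  by (simp add: monom_degree_def)

lemma monom_degree_single [simp]: "monom_degree (single v k) = k"
  by (simp add: monom_degree_def)

lemma monom_degree_eq_0_iff [simp]: "monom_degree m = 0 \<longleftrightarrow> m = 0"
  by (auto simp: monom_degree_def in_keys_iff intro: poly_mapping_eqI)

lemma monom_degree_sum: "monom_degree (sum f A) = (\<Sum>x\<in>A. monom_degree (f x))"
  by (induction A rule: infinite_finite_induct) (auto simp: monom_degree_add)

lemma finite_monomials_of_bounded_degree: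
  assumes "finite V"
  shows "finite {m :: 'v \<Rightarrow>\<^sub>0 nat. keys m \<subseteq> V \<and> monom_degree m \<le> N}"
proof -
  have "lookup ` {m :: 'v \<Rightarrow>\<^sub>0 nat. keys m \<subseteq> V \<and> monom_degree m \<le> N}
    \<subseteq> {f. \<forall>v. (v \<in> V \<longrightarrow> f v \<in> {..N}) \<and> (v \<notin> V \<longrightarrow> f v = 0)}"
  proof clarsimp
    fix m :: "'v \<Rightarrow>\<^sub>0 nat" and v assume m: "keys m \<subseteq> V" "monom_degree m \<le> N"
    have "lookup m v \<le> monom_degree m" if "v \<in> V"
      using member_le_sum[OF that, of "lookup m"] assms m(1) by (simp add: monom_degree_superset)
    then show "(v \<in> V \<longrightarrow> lookup m v \<le> N) \<and> (v \<notin> V \<longrightarrow> lookup m v = 0)"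
      using m by (auto simp: in_keys_iff)
  qed
  moreover have "finite {f. \<forall>v. (v \<in> V \<longrightarrow> f v \<in> {..N}) \<and> (v \<notin> V \<longrightarrow> f v = 0)}"
    by (rule finite_set_of_finite_funs) (use assms in auto)
  ultimately show ?thesis
    using inj_on_subset[of lookup UNIV] finite_imageD[of lookup] finite_subset
    by (metis (no_types, lifting) inj_onI poly_mapping_eqI)
qed


section \<open>Ideals of a polynomial ring\<close>

lemma mpoly_ring_single_closed: "keys m \<subseteq> V \<Longrightarrow> single m c \<in> carrier (mpoly_ring V)"
  by (simp add: mem_carrier_mpoly_ring)

text \<open>Every polynomial is a sum of terms, so absorption need only be checked for a single term.\<close>

lemma mpoly_idealI:
  fixes X :: "('v, 'k::comm_ring_1) mpoly set"
  assumes X: "X \<subseteq> carrier (mpoly_ring V)" and zero: "0 \<in> X"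
    and add: "\<And>p q. p \<in> X \<Longrightarrow> q \<in> X \<Longrightarrow> p + q \<in> X"
    and mult: "\<And>m c p. keys m \<subseteq> V \<Longrightarrow> p \<in> X \<Longrightarrow> single m c * p \<in> X"
  shows "ideal X (mpoly_ring V)"
proof -
  interpret cring "mpoly_ring V :: ('v, 'k) mpoly ring" by (rule mpoly_ring_cring)
  have neg: "- p \<in> X" if "p \<in> X" for p
    using mult[OF _ that, of 0 "-1"] by (simp add: single_uminus)
  have sum: "(\<Sum>a\<in>A. g a) \<in> X" if "\<And>a. a \<in> A \<Longrightarrow> g a \<in> X" for A and g :: "('v \<Rightarrow>\<^sub>0 nat) \<Rightarrow> _"
    using that by (induction A rule: infinite_finite_induct) (auto intro: zero add)
  have mul: "q * p \<in> X" if "q \<in> carrier (mpoly_ring V)" "p \<in> X" for p q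
  proof -
    have "q * p = (\<Sum>m\<in>keys q. single m (lookup q m) * p)"
      by (subst mpoly_as_sum[of q]) (simp add: sum_distrib_right)
    also have "\<dots> \<in> X"
      using that by (intro sum mult) (auto simp: mem_carrier_mpoly_ring)
    finally show ?thesis .
  qed
  show ?thesis
  proof (rule idealI)
    show "subgroup X (add_monoid (mpoly_ring V))"
    proof (rule add.subgroupI)
      show "\<ominus>\<^bsub>mpoly_ring V\<^esub> p \<in> X" if "p \<in> X" for p
      proof -
        have "\<ominus>\<^bsub>mpoly_ring V\<^esub> p = - p"
          by (rule minus_equality) (use that X neg in auto)
        then show ?thesis using neg that by simp
      qed
    qed (use X zero add in auto)
    show "p \<otimes>\<^bsub>mpoly_ring V\<^esub> q \<in> X" if "p \<in> X" "q \<in> carrier (mpoly_ring V)" for p q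
      using mul[OF that(2,1)] by (simp add: mult.commute)
  qed (use mul in \<open>auto intro: ring_axioms\<close>)
qed

context
  fixes V :: "'v set" and I :: "('v, 'k::comm_ring_1) mpoly set"
  assumes I: "ideal I (mpoly_ring V)"
begin

lemma mpoly_ideal_zero: "0 \<in> I"
  using additive_subgroup.zero_closed[OF ideal.axioms(1)[OF I]] by simp

lemma mpoly_ideal_add: "p \<in> I \<Longrightarrow> q \<in> I \<Longrightarrow> p + q \<in> I"
  using additive_subgroup.a_closed[OF ideal.axioms(1)[OF I]] by simp

lemma mpoly_ideal_mult: "p \<in> I \<Longrightarrow> keys m \<subseteq> V \<Longrightarrow> single m c * p \<in> I"
  using ideal.I_l_closed[OF I, of p "single m c"] mpoly_ring_single_closed by force

lemma mpoly_ideal_uminus: "p \<in> I \<Longrightarrow> - p \<in> I"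
  using mpoly_ideal_mult[of p 0 "-1"] by (simp add: single_uminus)

lemma mpoly_ideal_sum: "(\<And>a. a \<in> A \<Longrightarrow> g a \<in> I) \<Longrightarrow> (\<Sum>a\<in>A. g a) \<in> I"
  by (induction A rule: infinite_finite_induct) (auto intro: mpoly_ideal_zero mpoly_ideal_add)

end

lemma genideal_mpoly_ideal:
  "S \<subseteq> carrier (mpoly_ring V) \<Longrightarrow> ideal (genideal (mpoly_ring V) S) (mpoly_ring V)"
  by (rule ring.genideal_ideal[OF cring.axioms(1)[OF mpoly_ring_cring]])

lemma genideal_mpoly_superset:
  "S \<subseteq> carrier (mpoly_ring V) \<Longrightarrow> S \<subseteq> genideal (mpoly_ring V) S"
  by (rule ring.genideal_self[OF cring.axioms(1)[OF mpoly_ring_cring]])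

lemma genideal_mpoly_least:
  "ideal I (mpoly_ring V) \<Longrightarrow> S \<subseteq> I \<Longrightarrow> genideal (mpoly_ring V) S \<subseteq> I"
  by (rule ring.genideal_minimal[OF cring.axioms(1)[OF mpoly_ring_cring]])

lemma genideal_mpoly_mono:
  assumes "S \<subseteq> T" "T \<subseteq> carrier (mpoly_ring V)"
  shows "genideal (mpoly_ring V) S \<subseteq> genideal (mpoly_ring V) T"
  using assms genideal_mpoly_superset[of T V]
  by (intro genideal_mpoly_least genideal_mpoly_ideal) auto


section \<open>Weighted sums of coefficients\<close>

text \<open>The linear functional on polynomials that takes the value \<^term>\<open>g m\<close> on the monomial \<open>m\<close>. For
  \<open>g\<close> constant on the classes of a congruence of monomials, such functionals detect membership in
  the ideal that belongs to the congruence.\<close>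

definition weighted_sum :: "(('v \<Rightarrow>\<^sub>0 nat) \<Rightarrow> 'k) \<Rightarrow> ('v, 'k::comm_ring_1) mpoly \<Rightarrow> 'k" where
  "weighted_sum g p = (\<Sum>m\<in>keys p. lookup p m * g m)"

lemma weighted_sum_superset:
  "finite A \<Longrightarrow> keys p \<subseteq> A \<Longrightarrow> weighted_sum g p = (\<Sum>m\<in>A. lookup p m * g m)"
  unfolding weighted_sum_def by (rule sum.mono_neutral_left) (auto simp: in_keys_iff)

lemma weighted_sum_zero [simp]: "weighted_sum g 0 = 0"
  by (simp add: weighted_sum_def)

lemma weighted_sum_single [simp]: "weighted_sum g (single m c) = c * g m"
  by (simp add: weighted_sum_def)

lemma weighted_sum_add: "weighted_sum g (p + q) = weighted_sum g p + weighted_sum g q"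
proof -
  have "finite (keys p \<union> keys q)" by simp
  then show ?thesis
    using Poly_Mapping.keys_add[of p q]
    by (simp add: weighted_sum_superset[of "keys p \<union> keys q"] lookup_add distrib_right sum.distrib)
qed

lemma weighted_sum_diff: "weighted_sum g (p - q) = weighted_sum g p - weighted_sum g q"
  using weighted_sum_add[of g "p - q" q] by simp

lemma weighted_sum_sum: "weighted_sum g (sum f A) = (\<Sum>x\<in>A. weighted_sum g (f x))"
  by (induction A rule: infinite_finite_induct) (auto simp: weighted_sum_add)

text \<open>This is why kernels of weighted sums form ideals: multiplication by a monomial only shifts the
  weight, and the shift of a weight that is constant on the classes of a congruence is again
  constant on them.\<close>

lemma weighted_sum_monomial_mult:
  "weighted_sum g (single m c * p) = c * weighted_sum (\<lambda>u. g (m + u)) p"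
proof -
  have "single m c * p = (\<Sum>u\<in>keys p. single (m + u) (c * lookup p u))"
    by (subst mpoly_as_sum[of p]) (simp add: sum_distrib_left mult_single)
  then show ?thesis
    by (simp add: weighted_sum_sum sum_distrib_left mult.assoc) (simp add: weighted_sum_def sum_distrib_left)
qed

lemma weighted_sum_indicator: "weighted_sum (\<lambda>u. of_bool (u = m)) p = lookup p m"
  by (auto simp: weighted_sum_def of_bool_def if_distrib in_keys_iff cong: if_cong)


section \<open>Generating degrees\<close>

definition homogeneous_part :: "nat \<Rightarrow> ('v, 'k::comm_ring_1) mpoly \<Rightarrow> ('v, 'k) mpoly" where
  "homogeneous_part d p = (\<Sum>m\<in>{m \<in> keys p. monom_degree m = d}. single m (lookup p m))"

lemma lookup_homogeneous_part:
  "lookup (homogeneous_part d p) m = (if monom_degree m = d then lookup p m else 0)"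
  by (simp add: homogeneous_part_def lookup_sum lookup_single when_def in_keys_iff sum.delta')

lemma homogeneous_part_add:
  "homogeneous_part d (p + q) = homogeneous_part d p + homogeneous_part d q"
  by (rule poly_mapping_eqI) (simp add: lookup_homogeneous_part lookup_add)

lemma lookup_monomial_mult:
  fixes p :: "('v, 'k::comm_ring_1) mpoly"
  shows "lookup (single m c * p) (m + u) = c * lookup p u"
proof -
  have "lookup (single m c * p) (m + u) = weighted_sum (\<lambda>w. of_bool (w = m + u)) (single m c * p)"
    by (simp only: weighted_sum_indicator)
  also have "\<dots> = c * weighted_sum (\<lambda>w. of_bool (w = u)) p"
    by (simp only: weighted_sum_monomial_mult add_left_cancel)
  finally show ?thesis
    by (simp only: weighted_sum_indicator)
qed

lemma keys_monomial_mult: "keys (single m c * p) \<subseteq> (\<lambda>u. m + u) ` keys p"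
proof
  fix w assume "w \<in> keys (single m c * p)"
  then obtain a b where "w = a + b" "a \<in> keys (single m c)" "b \<in> keys p"
    using keys_mult[of "single m c" p] by blast
  then show "w \<in> (\<lambda>u. m + u) ` keys p"
    by (cases "c = 0") auto
qed

lemma homogeneous_part_monomial_mult:
  "homogeneous_part d (single m c * p) =
     (if monom_degree m \<le> d then single m c * homogeneous_part (d - monom_degree m) p else 0)"
proof (rule poly_mapping_eqI)
  fix w
  show "lookup (homogeneous_part d (single m c * p)) w = lookup
     (if monom_degree m \<le> d then single m c * homogeneous_part (d - monom_degree m) p else 0) w"
  proof (cases "\<exists>u. w = m + u")
    case True
    then show ?thesis
      by (auto simp: lookup_homogeneous_part lookup_monomial_mult monom_degree_add)
  next
    case False
    then have "w \<notin> keys (single m c * q)" for q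
      using keys_monomial_mult[of m c q] by blast
    then show ?thesis
      by (simp add: lookup_homogeneous_part in_keys_iff)
  qed
qed

lemma mpoly_degree_eqI:
  assumes "p \<noteq> 0" "\<And>m. m \<in> keys p \<Longrightarrow> monom_degree m = d"
  shows "mpoly_degree p = d"
proof -
  have "keys p \<noteq> {}" using assms(1) by simp
  then have "monom_degree ` keys p = {d}"
    using assms(2) by blast
  then show ?thesis
    by (simp add: mpoly_degree_def)
qed

lemma monom_degree_le_mpoly_degree: "m \<in> keys p \<Longrightarrow> monom_degree m \<le> mpoly_degree p"
  by (simp add: mpoly_degree_def)

lemma homogeneous_part_of_homogeneous:
  assumes "mpoly_homogeneous p"
  shows "homogeneous_part d p = 0 \<or> homogeneous_part d p = p \<and> mpoly_degree p = d"
proof (cases "homogeneous_part d p = 0")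
  case False
  then obtain m where m: "lookup (homogeneous_part d p) m \<noteq> 0"
    by (metis poly_mapping_eqI lookup_zero)
  then have "m \<in> keys p" "monom_degree m = d"
    by (auto simp: lookup_homogeneous_part in_keys_iff split: if_splits)
  then have d: "\<forall>m\<in>keys p. monom_degree m = d"
    using assms by (auto simp: mpoly_homogeneous_def)
  moreover have "homogeneous_part d p = p"
    using d by (intro poly_mapping_eqI) (auto simp: lookup_homogeneous_part in_keys_iff)
  ultimately show ?thesis
    using mpoly_degree_eqI[of p d] \<open>m \<in> keys p\<close> by auto
qed simp

lemma homogeneous_part_mpoly_degree:
  assumes "mpoly_homogeneous p"
  shows "homogeneous_part (mpoly_degree p) p = p"
proof (cases "p = 0")
  case True
  then show ?thesis by (simp add: homogeneous_part_def)
next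
  case False
  then have "keys p \<noteq> {}" by simp
  then obtain m where "m \<in> keys p" by blast
  then have "lookup (homogeneous_part (monom_degree m) p) m \<noteq> 0"
    by (simp add: lookup_homogeneous_part in_keys_iff)
  then have "homogeneous_part (monom_degree m) p \<noteq> 0" by auto
  then show ?thesis
    using homogeneous_part_of_homogeneous[OF assms] by metis
qed

text \<open>Elements of \<open>T\<close> of degree greater than \<open>d\<close> cannot contribute to the part of degree \<open>d\<close>. The
  polynomials with this property in all degrees form an ideal that contains \<open>T\<close>, so that no explicit
  representation of \<open>f\<close> by generators is used.\<close>

lemma homogeneous_part_in_truncated_genideal:
  fixes T :: "('v, 'k::comm_ring_1) mpoly set"
  assumes T: "T \<subseteq> carrier (mpoly_ring V)" and hom: "\<And>t. t \<in> T \<Longrightarrow> mpoly_homogeneous t"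
    and f: "f \<in> genideal (mpoly_ring V) T"
  shows "homogeneous_part d f \<in> genideal (mpoly_ring V) {t \<in> T. mpoly_degree t \<le> d}"
proof -
  define J where "J d = genideal (mpoly_ring V) {t \<in> T. mpoly_degree t \<le> d}" for d
  have J: "ideal (J d) (mpoly_ring V)" for d
    unfolding J_def using T by (intro genideal_mpoly_ideal) auto
  have J_mono: "J d \<subseteq> J e" if "d \<le> e" for d e
    unfolding J_def using T that by (intro genideal_mpoly_mono) auto
  define X where "X = {f \<in> carrier (mpoly_ring V). \<forall>d. homogeneous_part d f \<in> J d}"
  have "ideal X (mpoly_ring V)"
  proof (rule mpoly_idealI)
    show "0 \<in> X"
      using mpoly_ideal_zero[OF J] by (simp add: X_def homogeneous_part_def mem_carrier_mpoly_ring)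
    show "p + q \<in> X" if "p \<in> X" "q \<in> X" for p q
      using that mpoly_ideal_add[OF J] by (simp add: X_def homogeneous_part_add mpoly_ring_add_closed)
    show "single m c * p \<in> X" if m: "keys m \<subseteq> V" and p: "p \<in> X" for m c p
    proof -
      have "single m c * homogeneous_part (d - monom_degree m) p \<in> J d" for d
        using mpoly_ideal_mult[OF J _ m] p J_mono[of "d - monom_degree m" d] by (auto simp: X_def)
      then show ?thesis
        using p mpoly_ideal_zero[OF J]
        by (simp add: X_def mpoly_ring_mult_closed mpoly_ring_single_closed m
            homogeneous_part_monomial_mult)
    qed
  qed (simp add: X_def)
  moreover have "T \<subseteq> X"
  proof
    fix t assume t: "t \<in> T"
    have "homogeneous_part d t \<in> J d" for d
    proof (cases "homogeneous_part d t = 0")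
      case False
      then have "homogeneous_part d t = t" "mpoly_degree t = d"
        using homogeneous_part_of_homogeneous[OF hom[OF t]] by auto
      moreover have "{t \<in> T. mpoly_degree t \<le> d} \<subseteq> J d"
        unfolding J_def using T by (intro genideal_mpoly_superset) auto
      ultimately show ?thesis using t by auto
    qed (simp add: mpoly_ideal_zero[OF J])
    then show "t \<in> X" using t T by (auto simp: X_def)
  qed
  ultimately have "f \<in> X" using genideal_mpoly_least f by blast
  then show ?thesis by (simp add: X_def J_def)
qed

text \<open>The part of the graded Nakayama lemma that is used here. If the largest degree \<open>d\<close> in \<open>S\<close> exceeded
  all degrees in \<open>T\<close>, then the elements of \<open>S\<close> of smaller degree would already generate \<open>T\<close>, against
  the minimality of \<open>S\<close>.\<close>

lemma generating_degree_le:
  assumes S: "minimal_homogeneous_generators V I S" and T: "minimal_homogeneous_generators V I T"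
    and d: "f \<in> S" "mpoly_degree f = d" and e: "\<And>g. g \<in> T \<Longrightarrow> mpoly_degree g \<le> e"
  shows "d \<le> e"
proof (rule ccontr)
  assume "\<not> d \<le> e"
  define S' where "S' = {s \<in> S. mpoly_degree s \<le> e}"
  have "S' \<subset> S" using d \<open>\<not> d \<le> e\<close> by (auto simp: S'_def)
  have SV: "S \<subseteq> carrier (mpoly_ring V)" and TV: "T \<subseteq> carrier (mpoly_ring V)"
    and SI: "genideal (mpoly_ring V) S = I" and TI: "genideal (mpoly_ring V) T = I"
    using S T by (auto simp: minimal_homogeneous_generators_def)
  have "T \<subseteq> genideal (mpoly_ring V) S'"
  proof
    fix t assume t: "t \<in> T"
    have "t \<in> genideal (mpoly_ring V) S"
      using t genideal_mpoly_superset[OF TV] SI TI by blast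
    then have "homogeneous_part (mpoly_degree t) t \<in>
        genideal (mpoly_ring V) {s \<in> S. mpoly_degree s \<le> mpoly_degree t}"
      using SV S by (intro homogeneous_part_in_truncated_genideal)
        (auto simp: minimal_homogeneous_generators_def)
    then have "t \<in> genideal (mpoly_ring V) {s \<in> S. mpoly_degree s \<le> mpoly_degree t}"
      using t T by (simp add: homogeneous_part_mpoly_degree minimal_homogeneous_generators_def)
    also have "\<dots> \<subseteq> genideal (mpoly_ring V) S'"
      using SV e[OF t] by (intro genideal_mpoly_mono) (auto simp: S'_def)
    finally show "t \<in> genideal (mpoly_ring V) S'" .
  qed
  then have "I \<subseteq> genideal (mpoly_ring V) S'"
    using genideal_mpoly_least[OF genideal_mpoly_ideal, of S' V T] SV TI \<open>S' \<subset> S\<close> by auto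
  moreover have "genideal (mpoly_ring V) S' \<subseteq> I"
    using genideal_mpoly_mono[of S' S V] SV SI \<open>S' \<subset> S\<close> by auto
  moreover have "genideal (mpoly_ring V) S' \<noteq> I"
    using S \<open>S' \<subset> S\<close> unfolding minimal_homogeneous_generators_def by metis
  ultimately show False by blast
qed

lemma max_generating_degree_eqI:
  assumes "minimal_homogeneous_generators V I S" "f \<in> S" "mpoly_degree f = d"
    and "\<And>g. g \<in> S \<Longrightarrow> mpoly_degree g \<le> d"
  shows "max_generating_degree V I = d"
  unfolding max_generating_degree_def
proof (rule the_equality)
  show "\<exists>S. minimal_homogeneous_generators V I S \<and> (\<exists>f\<in>S. mpoly_degree f = d) \<and>
      (\<forall>f\<in>S. mpoly_degree f \<le> d)"
    using assms by blast
  show "e = d" if "\<exists>S. minimal_homogeneous_generators V I S \<and> (\<exists>f\<in>S. mpoly_degree f = e) \<and>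
      (\<forall>f\<in>S. mpoly_degree f \<le> e)" for e
    using that assms generating_degree_le by (metis order_antisym)
qed

text \<open>Among the generating subsets of a finite generating set, one of least cardinality is minimal.\<close>

lemma exists_minimal_homogeneous_generators:
  assumes "finite Q" "Q \<subseteq> carrier (mpoly_ring V)" "\<And>f. f \<in> Q \<Longrightarrow> mpoly_homogeneous f"
  obtains S where "S \<subseteq> Q" "minimal_homogeneous_generators V (genideal (mpoly_ring V) Q) S"
proof -
  let ?P = "\<lambda>S. S \<subseteq> Q \<and> genideal (mpoly_ring V) S = genideal (mpoly_ring V) Q"
  have "?P Q" by simp
  then obtain S where S: "?P S" and min: "\<And>T. ?P T \<Longrightarrow> card S \<le> card T"
    using ex_has_least_nat[of ?P Q card] by blast
  have "finite S" using S assms(1) finite_subset by blast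
  have "genideal (mpoly_ring V) T \<noteq> genideal (mpoly_ring V) Q" if "T \<subset> S" for T
  proof
    assume "genideal (mpoly_ring V) T = genideal (mpoly_ring V) Q"
    then have "card S \<le> card T" using that S by (intro min) blast
    then show False using psubset_card_mono[OF \<open>finite S\<close> that] by simp
  qed
  moreover have "S \<subseteq> carrier (mpoly_ring V)" "\<forall>f\<in>S. mpoly_homogeneous f"
    using S assms by blast+
  ultimately have "minimal_homogeneous_generators V (genideal (mpoly_ring V) Q) S"
    using S unfolding minimal_homogeneous_generators_def by blast
  then show thesis using that S by blast
qed


section \<open>Congruences of monomials\<close>

text \<open>The relation ``the binomial \<open>t\<^sup>a - t\<^sup>b\<close> lies in a given ideal'' is of this kind, which turns ideal
  membership of binomials into the combinatorics of exponent vectors.\<close>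

locale monomial_congruence =
  fixes V :: "'v set" and R :: "('v \<Rightarrow>\<^sub>0 nat) \<Rightarrow> ('v \<Rightarrow>\<^sub>0 nat) \<Rightarrow> bool"
  assumes rel_refl: "R a a"
    and rel_sym: "R a b \<Longrightarrow> R b a"
    and rel_trans: "R a b \<Longrightarrow> R b c \<Longrightarrow> R a c"
    and add_left: "R a b \<Longrightarrow> keys c \<subseteq> V \<Longrightarrow> R (c + a) (c + b)"

lemma binomial_congruence:
  fixes I :: "('v, 'k::comm_ring_1) mpoly set"
  assumes I: "ideal I (mpoly_ring V)"
  shows "monomial_congruence V (\<lambda>a b. single a 1 - single b 1 \<in> I)"
proof
  show "single a 1 - single a 1 \<in> I" for a
    using mpoly_ideal_zero[OF I] by simp
  show "single b 1 - single a 1 \<in> I" if "single a 1 - single b 1 \<in> I" for a b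
    using mpoly_ideal_uminus[OF I that] by simp
  show "single a 1 - single c 1 \<in> I"
    if "single a 1 - single b 1 \<in> I" "single b 1 - single c 1 \<in> I" for a b c
    using mpoly_ideal_add[OF I that] by simp
  show "single (c + a) 1 - single (c + b) 1 \<in> I"
    if "single a 1 - single b 1 \<in> I" "keys c \<subseteq> V" for a b c
    using mpoly_ideal_mult[OF I that, of 1] by (simp add: right_diff_distrib mult_single)
qed

text \<open>The congruence that the polynomials \<open>x\<^sub>i\<^sup>2 - x\<^sub>j\<^sup>2\<close> induce on monomials in the vertices.\<close>

definition parity_equiv :: "('v \<Rightarrow>\<^sub>0 nat) \<Rightarrow> ('v \<Rightarrow>\<^sub>0 nat) \<Rightarrow> bool" where
  "parity_equiv u w \<longleftrightarrow> monom_degree u = monom_degree w \<and> (\<forall>v. even (lookup u v) \<longleftrightarrow> even (lookup w v))"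

lemma parity_equiv_refl: "parity_equiv u u"
  and parity_equiv_sym: "parity_equiv u w \<Longrightarrow> parity_equiv w u"
  and parity_equiv_trans: "parity_equiv u w \<Longrightarrow> parity_equiv w x \<Longrightarrow> parity_equiv u x"
  by (auto simp: parity_equiv_def)

lemma parity_equiv_add: "parity_equiv u w \<Longrightarrow> parity_equiv x y \<Longrightarrow> parity_equiv (u + x) (w + y)"
  by (auto simp: parity_equiv_def monom_degree_add lookup_add)

lemma parity_equiv_cancel_left [simp]: "parity_equiv (m + u) (m + w) \<longleftrightarrow> parity_equiv u w"
  by (auto simp: parity_equiv_def monom_degree_add lookup_add)

lemma parity_equiv_squares: "parity_equiv (single i 2) (single j 2)"
  by (auto simp: parity_equiv_def lookup_single when_def)

text \<open>Induction on the degree: a common variable of \<open>u\<close> and \<open>w\<close> is cancelled; if there is none, then all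
  exponents of \<open>u\<close> and \<open>w\<close> are even, and a square in \<open>u\<close> is exchanged for a square in \<open>w\<close>.\<close>

lemma (in monomial_congruence) parity_equiv_imp_related:
  assumes squares: "\<And>i j. i \<in> V \<Longrightarrow> j \<in> V \<Longrightarrow> R (single i 2) (single j 2)"
    and "keys u \<subseteq> V" "keys w \<subseteq> V" "parity_equiv u w"
  shows "R u w"
  using assms(2-4)
proof (induction "monom_degree u" arbitrary: u w rule: less_induct)
  case less
  have deg: "monom_degree u = monom_degree w" using less.prems by (simp add: parity_equiv_def)
  show ?case
  proof (cases "u = 0")
    case True
    then have "w = 0" using deg by simp
    with True show ?thesis by (simp add: rel_refl)
  next
    case False
    then have "w \<noteq> 0" using deg by (metis monom_degree_eq_0_iff)
    \<comment> \<open>\<open>k\<close> is 1 when a common variable \<open>i = j\<close> is cancelled, and 2 when squares are exchanged.\<close>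
    obtain i j k where ij: "i \<in> V" "j \<in> V" "k \<le> lookup u i" "k \<le> lookup w j" "0 < k"
      "R (single i k) (single j k)" "parity_equiv (single i k) (single j k)"
    proof (cases "keys u \<inter> keys w = {}")
      case True
      obtain i j where i: "i \<in> keys u" and j: "j \<in> keys w"
        using \<open>u \<noteq> 0\<close> \<open>w \<noteq> 0\<close> by (metis all_not_in_conv keys_eq_empty)
      then have "lookup w i = 0" "lookup u j = 0"
        using True by (auto simp: in_keys_iff)
      then have "even (lookup u i)" "even (lookup w j)"
        using less.prems(3) by (metis parity_equiv_def even_zero)+
      moreover have "lookup u i \<noteq> 0" "lookup w j \<noteq> 0"
        using i j by (auto simp: in_keys_iff)
      ultimately have "2 \<le> lookup u i" "2 \<le> lookup w j"
        by presburger+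
      then show thesis
        using i j less.prems by (intro that[of i j 2] squares parity_equiv_squares) auto
    next
      case False
      then obtain i where i: "i \<in> keys u" "i \<in> keys w" by blast
      then have "1 \<le> lookup u i" "1 \<le> lookup w i" by (auto simp: in_keys_iff)
      then show thesis
        using i less.prems by (intro that[of i i 1] rel_refl parity_equiv_refl) auto
    qed
    define u' w' where "u' = u - single i k" and "w' = w - single j k"
    have u: "u = single i k + u'" and w: "w = single j k + w'"
      using ij by (simp_all add: u'_def w'_def single_plus_minus)
    have keys: "keys u' \<subseteq> V" "keys w' \<subseteq> V"
      using keys_minus_nat[of u "single i k"] keys_minus_nat[of w "single j k"] less.prems
      by (auto simp: u'_def w'_def)
    have "parity_equiv (single i k + u') (single i k + w')"
      using less.prems(3) parity_equiv_add[OF ij(7) parity_equiv_refl, of w']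
      unfolding u w by (blast intro: parity_equiv_sym parity_equiv_trans)
    moreover have "monom_degree u' < monom_degree u"
      using ij by (simp add: u monom_degree_add)
    ultimately have "R u' w'"
      using less.hyps keys by simp
    then have "R (single i k + u') (single i k + w')"
      using ij by (intro add_left) auto
    moreover have "R (w' + single i k) (w' + single j k)"
      using ij keys by (intro add_left) auto
    ultimately show ?thesis
      unfolding u w using rel_trans by (metis add.commute)
  qed
qed


section \<open>Membership in the Eulerian ideal\<close>

text \<open>The exponent vector of the image of \<open>t\<^sup>a\<close> under \<^const>\<open>edge_hom\<close>; its value at \<open>v\<close> is the degree of \<open>v\<close>
  in the multigraph \<open>a\<close>.\<close>

definition endpoint_monomial :: "('a set \<Rightarrow>\<^sub>0 nat) \<Rightarrow> ('a \<Rightarrow>\<^sub>0 nat)" where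
  "endpoint_monomial a = (\<Sum>e\<in>keys a. \<Sum>v\<in>e. single v (lookup a e))"

lemma endpoint_monomial_superset:
  "finite A \<Longrightarrow> keys a \<subseteq> A \<Longrightarrow> endpoint_monomial a = (\<Sum>e\<in>A. \<Sum>v\<in>e. single v (lookup a e))"
  unfolding endpoint_monomial_def by (rule sum.mono_neutral_left) (auto simp: in_keys_iff)

lemma endpoint_monomial_add:
  "endpoint_monomial (a + b) = endpoint_monomial a + endpoint_monomial b"
proof -
  have "finite (keys a \<union> keys b)" by simp
  then show ?thesis
    by (simp add: endpoint_monomial_superset[of "keys a \<union> keys b"] keys_add_nat lookup_add
        sum.distrib single_add)
qed

lemma endpoint_monomial_zero [simp]: "endpoint_monomial 0 = 0"
  by (simp add: endpoint_monomial_def)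

lemma endpoint_monomial_single [simp]: "endpoint_monomial (single e k) = (\<Sum>v\<in>e. single v k)"
  by (simp add: endpoint_monomial_def)

lemma endpoint_monomial_sum: "endpoint_monomial (sum f A) = (\<Sum>x\<in>A. endpoint_monomial (f x))"
  by (induction A rule: infinite_finite_induct) (auto simp: endpoint_monomial_add)

lemma edge_hom_single:
  "edge_hom (single m c) = (single (endpoint_monomial m) c :: ('a, 'k::field) mpoly)"
proof -
  have edge: "(\<Prod>i\<in>e. mvar i :: ('a, 'k) mpoly) = single (\<Sum>i\<in>e. single i 1) 1" for e
    by (induction e rule: infinite_finite_induct) (auto simp: mvar_def mult_single)
  have pow: "(single (\<Sum>i\<in>e. single i 1) 1 :: ('a, 'k) mpoly) ^ k = single (\<Sum>i\<in>e. single i k) 1"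
    for e k
  proof (induction k)
    case (Suc k)
    have "(\<Sum>i\<in>e. single i (Suc k)) = (\<Sum>i\<in>e. single i 1) + (\<Sum>i\<in>e. single i k :: 'a \<Rightarrow>\<^sub>0 nat)"
      by (simp only: sum.distrib[symmetric] single_add[symmetric] plus_1_eq_Suc)
    then show ?case by (simp only: power_Suc Suc mult_single mult_1)
  qed simp
  have prod: "(\<Prod>e\<in>A. single (f e) 1 :: ('a, 'k) mpoly) = single (\<Sum>e\<in>A. f e) 1"
    for A and f :: "'a set \<Rightarrow> _"
    by (induction A rule: infinite_finite_induct) (auto simp: mult_single)
  show ?thesis
    unfolding edge_hom_def mpoly_subst_single edge pow prod
    by (simp add: endpoint_monomial_def mconst_def mult_single)
qed

lemma edge_hom_add: "edge_hom (p + q) = edge_hom p + edge_hom q"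
  by (simp add: edge_hom_def mpoly_subst_add)

lemma edge_hom_mult: "edge_hom (p * q) = edge_hom p * edge_hom q"
  by (simp add: edge_hom_def mpoly_subst_mult)

lemma edge_hom_diff: "edge_hom (p - q) = edge_hom p - edge_hom q"
  using edge_hom_add[of "p - q" q] by simp

lemma weighted_sum_edge_hom:
  "weighted_sum g (edge_hom p) = weighted_sum (\<lambda>m. g (endpoint_monomial m)) p"
proof -
  have "edge_hom p = (\<Sum>m\<in>keys p. single (endpoint_monomial m) (lookup p m))"
    by (subst mpoly_as_sum[of p]) (simp add: edge_hom_def mpoly_subst_sum flip: edge_hom_single)
  then show ?thesis
    by (simp add: weighted_sum_sum) (simp add: weighted_sum_def)
qed

lemma keys_endpoint_monomial: "keys a \<subseteq> E \<Longrightarrow> \<Union>E \<subseteq> V \<Longrightarrow> keys (endpoint_monomial a) \<subseteq> V"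
proof -
  assume a: "keys a \<subseteq> E" "\<Union>E \<subseteq> V"
  have sum: "keys (\<Sum>x\<in>A. f x) \<subseteq> V" if "\<And>x. x \<in> A \<Longrightarrow> keys (f x) \<subseteq> V"
    for A and f :: "'c \<Rightarrow> 'a \<Rightarrow>\<^sub>0 nat"
    using that by (induction A rule: infinite_finite_induct) (auto simp: keys_add_nat)
  show ?thesis
    unfolding endpoint_monomial_def by (intro sum) (use a in auto)
qed

definition vertex_squares :: "'a set \<Rightarrow> ('a, 'k::field) mpoly set" where
  "vertex_squares V = {mvar i ^ 2 - mvar j ^ 2 | i j. i \<in> V \<and> j \<in> V}"

lemma mvar_power2: "mvar i ^ 2 = (single (single i 2) 1 :: ('a, 'k::comm_ring_1) mpoly)"
  by (simp add: mvar_def power2_eq_square mult_single numeral_2_eq_2 flip: single_add)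

lemma vertex_squares_subset: "vertex_squares V \<subseteq> carrier (mpoly_ring V)"
proof
  fix p :: "('a, 'k::field) mpoly" assume "p \<in> vertex_squares V"
  then obtain i j where ij: "p = mvar i ^ 2 - mvar j ^ 2" "i \<in> V" "j \<in> V"
    by (auto simp: vertex_squares_def)
  have "p = single (single i 2) 1 + single (single j 2) (- 1)"
    by (simp add: ij mvar_power2 single_uminus)
  also have "\<dots> \<in> carrier (mpoly_ring V)"
    using ij by (intro mpoly_ring_add_closed mpoly_ring_single_closed) auto
  finally show "p \<in> carrier (mpoly_ring V)" .
qed

lemma eulerian_ideal_iff:
  "p \<in> eulerian_ideal V E \<longleftrightarrow>
     p \<in> carrier (mpoly_ring E) \<and> edge_hom p \<in> genideal (mpoly_ring V) (vertex_squares V)"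
  by (simp add: eulerian_ideal_def vertex_squares_def)

lemma eulerian_ideal_ideal:
  assumes "\<Union>E \<subseteq> V"
  shows "ideal (eulerian_ideal V E :: ('a set, 'k::field) mpoly set) (mpoly_ring E)"
proof (rule mpoly_idealI)
  have J: "ideal (genideal (mpoly_ring V) (vertex_squares V :: ('a, 'k) mpoly set)) (mpoly_ring V)"
    by (intro genideal_mpoly_ideal vertex_squares_subset)
  show "0 \<in> (eulerian_ideal V E :: ('a set, 'k) mpoly set)"
    using mpoly_ideal_zero[OF J]
    by (simp add: eulerian_ideal_iff edge_hom_def mem_carrier_mpoly_ring)
  show "p + q \<in> eulerian_ideal V E"
    if "p \<in> eulerian_ideal V E" "q \<in> eulerian_ideal V E" for p q :: "('a set, 'k) mpoly"
    using that mpoly_ideal_add[OF J] by (simp add: eulerian_ideal_iff edge_hom_add mpoly_ring_add_closed)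
  show "single m c * p \<in> eulerian_ideal V E"
    if "keys m \<subseteq> E" "p \<in> eulerian_ideal V E" for m c and p :: "('a set, 'k) mpoly"
    using that mpoly_ideal_mult[OF J] keys_endpoint_monomial[OF that(1) assms]
    by (simp add: eulerian_ideal_iff edge_hom_mult edge_hom_single mpoly_ring_mult_closed
        mpoly_ring_single_closed)
qed (simp add: eulerian_ideal_def)

text \<open>For monomials in the edges of a simple graph this says that \<open>a\<close> and \<open>b\<close> have the same degree and that
  all vertices have even degree in the multigraph \<open>a + b\<close>.\<close>

definition eulerian_equiv :: "'a set set \<Rightarrow> ('a set \<Rightarrow>\<^sub>0 nat) \<Rightarrow> ('a set \<Rightarrow>\<^sub>0 nat) \<Rightarrow> bool" where
  "eulerian_equiv E a b \<longleftrightarrow>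
     keys a \<subseteq> E \<and> keys b \<subseteq> E \<and> parity_equiv (endpoint_monomial a) (endpoint_monomial b)"

lemma eulerian_equiv_binomial:
  assumes "\<Union>E \<subseteq> V" "eulerian_equiv E a b"
  shows "single a 1 - single b 1 \<in> (eulerian_ideal V E :: ('a set, 'k::field) mpoly set)"
proof -
  let ?J = "genideal (mpoly_ring V) (vertex_squares V) :: ('a, 'k) mpoly set"
  have ab: "keys a \<subseteq> E" "keys b \<subseteq> E" "parity_equiv (endpoint_monomial a) (endpoint_monomial b)"
    using assms by (auto simp: eulerian_equiv_def)
  interpret monomial_congruence V "\<lambda>u w. single u 1 - single w 1 \<in> ?J"
    by (intro binomial_congruence genideal_mpoly_ideal vertex_squares_subset)
  have "single (single i 2) 1 - single (single j 2) 1 \<in> ?J" if "i \<in> V" "j \<in> V" for i j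
  proof (rule subsetD[OF genideal_mpoly_superset[OF vertex_squares_subset]])
    show "single (single i 2) 1 - single (single j 2) 1 \<in> (vertex_squares V :: ('a, 'k) mpoly set)"
      using that unfolding vertex_squares_def mvar_power2 by blast
  qed
  then have "single (endpoint_monomial a) 1 - single (endpoint_monomial b) 1 \<in> ?J"
    by (rule parity_equiv_imp_related)
      (use ab keys_endpoint_monomial[OF _ assms(1)] in simp_all)
  moreover have "single a 1 - single b 1 \<in> carrier (mpoly_ring E :: ('a set, 'k) mpoly ring)"
    using mpoly_ring_add_closed[OF mpoly_ring_single_closed[OF ab(1), of 1]
        mpoly_ring_single_closed[OF ab(2), of "-1"]] by (simp add: single_uminus)
  ultimately show ?thesis
    by (simp add: eulerian_ideal_iff edge_hom_diff edge_hom_single)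
qed

text \<open>The polynomials in the vertices that are annihilated by all class-invariant weights form an ideal
  containing the generators \<open>x\<^sub>i\<^sup>2 - x\<^sub>j\<^sup>2\<close>; the claim is the preimage of this under \<^const>\<open>edge_hom\<close>.
  The quantification over all invariant weights in the definition of \<open>X\<close> is what makes \<open>X\<close> closed under
  multiplication.\<close>

lemma weighted_sum_eulerian_ideal:
  fixes p :: "('a set, 'k::field) mpoly"
  assumes "p \<in> eulerian_ideal V E" and g: "\<And>u w. parity_equiv u w \<Longrightarrow> g u = g w"
  shows "weighted_sum (\<lambda>m. g (endpoint_monomial m)) p = 0"
proof -
  define X :: "('a, 'k) mpoly set" where
    "X = {q \<in> carrier (mpoly_ring V). \<forall>g. (\<forall>u w. parity_equiv u w \<longrightarrow> g u = g w) \<longrightarrow> weighted_sum g q = 0}"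
  have "ideal X (mpoly_ring V)"
  proof (rule mpoly_idealI)
    show "single m c * q \<in> X" if m: "keys m \<subseteq> V" and q: "q \<in> X" for m c q
      using q by (auto simp: X_def weighted_sum_monomial_mult mpoly_ring_mult_closed
          mpoly_ring_single_closed m)
    show "p + q \<in> X" if "p \<in> X" "q \<in> X" for p q
      using that by (simp add: X_def weighted_sum_add mpoly_ring_add_closed)
  qed (auto simp: X_def mem_carrier_mpoly_ring)
  moreover have "vertex_squares V \<subseteq> X"
  proof
    fix q :: "('a, 'k) mpoly" assume q: "q \<in> vertex_squares V"
    then obtain i j where "q = single (single i 2) 1 - single (single j 2) 1"
      unfolding vertex_squares_def mvar_power2 by blast
    then show "q \<in> X"
      using q vertex_squares_subset[of V] parity_equiv_squares[of i j]
      by (auto simp: X_def weighted_sum_diff)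
  qed
  ultimately have "edge_hom p \<in> X"
    using genideal_mpoly_least[of X V "vertex_squares V"] assms(1) by (auto simp: eulerian_ideal_iff)
  then have "weighted_sum g (edge_hom p) = 0"
    using g by (auto simp: X_def)
  then show ?thesis by (simp add: weighted_sum_edge_hom)
qed

text \<open>The Eulerian ideal is spanned by its binomials: replace each monomial of \<open>p\<close> by a fixed representative
  of its class. The differences are binomials in \<open>X\<close>, and what remains is 0, because its coefficient
  at a representative is the sum of the coefficients of \<open>p\<close> over a whole class.\<close>

lemma eulerian_ideal_least:
  fixes X :: "('a set, 'k::field) mpoly set"
  assumes X: "ideal X (mpoly_ring E)"
    and bin: "\<And>a b. eulerian_equiv E a b \<Longrightarrow> single a 1 - single b 1 \<in> X"
  shows "eulerian_ideal V E \<subseteq> X"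
proof
  fix p :: "('a set, 'k) mpoly" assume p: "p \<in> eulerian_ideal V E"
  define r where "r u = (SOME b. keys b \<subseteq> E \<and> parity_equiv (endpoint_monomial b) u)" for u
  have r_cong: "r u = r w" if "parity_equiv u w" for u w
    using that unfolding r_def by (metis parity_equiv_sym parity_equiv_trans)
  let ?r = "\<lambda>m. r (endpoint_monomial m)"
  have r: "eulerian_equiv E m (?r m)" if "keys m \<subseteq> E" for m
  proof -
    have "keys (?r m) \<subseteq> E \<and> parity_equiv (endpoint_monomial (?r m)) (endpoint_monomial m)"
      unfolding r_def by (rule someI[of _ m]) (use that parity_equiv_refl in auto)
    then show ?thesis using that by (simp add: eulerian_equiv_def parity_equiv_sym)
  qed
  let ?c = "lookup p"
  have rest: "(\<Sum>m\<in>keys p. single (?r m) (?c m)) = 0"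
  proof (rule poly_mapping_eqI)
    fix w
    have "lookup (\<Sum>m\<in>keys p. single (?r m) (?c m)) w =
        weighted_sum (\<lambda>m. of_bool (r (endpoint_monomial m) = w)) p"
      unfolding lookup_sum weighted_sum_def
      by (intro sum.cong refl) (simp add: lookup_single when_def of_bool_def)
    also have "\<dots> = 0"
      by (rule weighted_sum_eulerian_ideal[OF p]) (simp add: r_cong)
    finally show "lookup (\<Sum>m\<in>keys p. single (?r m) (?c m)) w = lookup 0 w" by simp
  qed
  have "p = (\<Sum>m\<in>keys p. single m (?c m)) - (\<Sum>m\<in>keys p. single (?r m) (?c m))"
    by (simp add: rest flip: mpoly_as_sum)
  also have "\<dots> = (\<Sum>m\<in>keys p. single 0 (?c m) * (single m 1 - single (?r m) 1))"
    by (simp add: right_diff_distrib mult_single sum_subtractf)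
  also have "\<dots> \<in> X"
    using p by (intro mpoly_ideal_sum[OF X] mpoly_ideal_mult[OF X] bin r)
      (auto simp: eulerian_ideal_iff mem_carrier_mpoly_ring)
  finally show "p \<in> X" .
qed


section \<open>Even subgraphs and cycles\<close>

definition vertex_degree :: "'a set set \<Rightarrow> 'a \<Rightarrow> nat" where
  "vertex_degree C v = (\<Sum>e\<in>C. of_bool (v \<in> e))"

definition even_subgraph :: "'a set set \<Rightarrow> bool" where
  "even_subgraph C \<longleftrightarrow> finite C \<and> (\<forall>e\<in>C. card e = 2) \<and> (\<forall>v. even (vertex_degree C v))"

lemma vertex_degree_Un:
  "finite A \<Longrightarrow> finite B \<Longrightarrow> A \<inter> B = {} \<Longrightarrow>
    vertex_degree (A \<union> B) v = vertex_degree A v + vertex_degree B v"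
  unfolding vertex_degree_def by (rule sum.union_disjoint)

lemma even_subgraph_Diff:
  assumes "even_subgraph W" "even_subgraph D" "D \<subseteq> W"
  shows "even_subgraph (W - D)"
proof -
  have "vertex_degree W v = vertex_degree D v + vertex_degree (W - D) v" for v
    using vertex_degree_Un[of D "W - D" v] assms
    by (simp add: even_subgraph_def Un_absorb1)
  then show ?thesis
    using assms unfolding even_subgraph_def by (metis Diff_iff even_add finite_Diff)
qed

lemma simple_graph_edges_in_vertices: "simple_graph V E \<Longrightarrow> \<Union>E \<subseteq> V"
  and simple_graph_card_edge: "simple_graph V E \<Longrightarrow> e \<in> E \<Longrightarrow> card e = 2"
  and simple_graph_finite_vertices: "simple_graph V E \<Longrightarrow> finite V"
  by (auto simp: simple_graph_def)

lemma simple_graph_finite_edges: "simple_graph V E \<Longrightarrow> finite E"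
  using simple_graph_edges_in_vertices[of V E] simple_graph_finite_vertices[of V E]
  by (metis finite_UnionD finite_subset)

text \<open>Each edge has exactly one endpoint on a fixed side of the bipartition, so the number of edges is the sum of the degrees on that side.\<close>

lemma even_subgraph_even_card:
  assumes "bipartite V E" "finite V" "even_subgraph C" "C \<subseteq> E"
  shows "even (card C)"
proof -
  obtain A B where AB: "A \<union> B = V" "A \<inter> B = {}" and E: "\<forall>e\<in>E. \<exists>a\<in>A. \<exists>b\<in>B. e = {a, b}"
    using assms(1) unfolding bipartite_def by (elim exE conjE)
  have "finite A" using AB assms(2) by auto
  have "(\<Sum>v\<in>A. of_bool (v \<in> e)) = (1 :: nat)" if "e \<in> C" for e
  proof -
    obtain a b where "a \<in> A" "b \<in> B" "e = {a, b}"
      using bspec[OF E subsetD[OF assms(4) \<open>e \<in> C\<close>]] by (elim bexE)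
    then have "A \<inter> {v. v \<in> e} = {a}" using AB by auto
    then show ?thesis using \<open>finite A\<close> by simp
  qed
  then have "card C = (\<Sum>e\<in>C. \<Sum>v\<in>A. of_bool (v \<in> e))" by simp
  also have "\<dots> = (\<Sum>v\<in>A. vertex_degree C v)"
    unfolding vertex_degree_def by (rule sum.swap)
  finally show ?thesis
    using assms(3) by (simp add: even_subgraph_def dvd_sum)
qed

definition cycle_edge :: "'a list \<Rightarrow> nat \<Rightarrow> 'a set" where
  "cycle_edge c i = {c ! i, c ! (Suc i mod length c)}"

lemma cycle_edges_image: "cycle_edges c = cycle_edge c ` {..<length c}"
  by (auto simp: cycle_edges_def cycle_edge_def)

lemma inj_on_cycle_edge:
  assumes "distinct c" "3 \<le> length c"
  shows "inj_on (cycle_edge c) {..<length c}"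
proof (rule inj_onI)
  fix i j assume ij: "i \<in> {..<length c}" "j \<in> {..<length c}" "cycle_edge c i = cycle_edge c j"
  show "i = j"
  proof (rule ccontr)
    assume "i \<noteq> j"
    have "0 < length c" using assms(2) by linarith
    then have less: "Suc i mod length c < length c" "Suc j mod length c < length c"
      by (rule mod_less_divisor)+
    have "c ! i \<noteq> c ! j" using ij assms \<open>i \<noteq> j\<close> by (simp add: nth_eq_iff_index_eq)
    then have "c ! i = c ! (Suc j mod length c)" "c ! j = c ! (Suc i mod length c)"
      using ij(3) by (auto simp: cycle_edge_def doubleton_eq_iff)
    then have "i = Suc j mod length c" "j = Suc i mod length c"
      using ij less assms(1) by (simp_all add: nth_eq_iff_index_eq)
    moreover have "Suc k mod length c = (if Suc k = length c then 0 else Suc k)"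
      if "k < length c" for k using that by auto
    ultimately show False
      using assms(2) ij(1,2) by (auto split: if_splits)
  qed
qed

lemma card_cycle_edges: "is_cycle E c \<Longrightarrow> card (cycle_edges c) = length c"
  by (simp add: is_cycle_def cycle_edges_image card_image inj_on_cycle_edge)

lemma sum_cyclic_shift:
  "(\<Sum>i<n. f (Suc i mod n)) = (\<Sum>i<n. f i :: 'b::comm_monoid_add)"
proof (cases n)
  case (Suc k)
  have "(\<Sum>i<k. f (Suc i mod Suc k)) = (\<Sum>i<k. f (Suc i))"
    by (rule sum.cong) auto
  then show ?thesis
    unfolding Suc sum.lessThan_Suc_shift[of f] by (simp add: add.commute)
qed simp

lemma cycle_edge_memb:
  assumes "distinct c" "3 \<le> length c" "i < length c"
  shows "(of_bool (v \<in> cycle_edge c i) :: nat) =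
    of_bool (v = c ! i) + of_bool (v = c ! (Suc i mod length c))"
proof -
  have "i \<noteq> Suc i mod length c" "Suc i mod length c < length c"
    using assms by (auto simp: mod_Suc)
  then have "c ! i \<noteq> c ! (Suc i mod length c)"
    using assms by (simp add: nth_eq_iff_index_eq)
  then show ?thesis by (auto simp: cycle_edge_def)
qed

lemma even_subgraph_cycle:
  assumes "is_cycle E c" "\<And>e. e \<in> E \<Longrightarrow> card e = 2"
  shows "even_subgraph (cycle_edges c)"
proof -
  have c: "distinct c" "3 \<le> length c" using assms by (auto simp: is_cycle_def)
  have "vertex_degree (cycle_edges c) v = 2 * (\<Sum>i<length c. of_bool (v = c ! i))" for v
  proof -
    have "vertex_degree (cycle_edges c) v = (\<Sum>i<length c. of_bool (v \<in> cycle_edge c i))"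
      using inj_on_cycle_edge[OF c] by (simp only: vertex_degree_def cycle_edges_image sum.reindex o_def)
    also have "\<dots> = (\<Sum>i<length c. of_bool (v = c ! i) + of_bool (v = c ! (Suc i mod length c)))"
      by (rule sum.cong) (use cycle_edge_memb[OF c] in auto)
    also have "\<dots> = 2 * (\<Sum>i<length c. of_bool (v = c ! i))"
      unfolding sum.distrib sum_cyclic_shift[of "\<lambda>i. of_bool (v = c ! i)"] by simp
    finally show ?thesis .
  qed
  then show ?thesis
    using assms by (auto simp: even_subgraph_def is_cycle_def cycle_edges_image)
qed

text \<open>The first vertex of a longest path has a second neighbour, since its degree is even and positive; by
  maximality this neighbour lies on the path and closes a cycle.\<close>

lemma even_subgraph_contains_cycle:
  assumes W: "even_subgraph W" and "W \<noteq> {}"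
  obtains c where "is_cycle W c"
proof -
  have fin: "finite W" and two: "\<And>e. e \<in> W \<Longrightarrow> card e = 2"
    using W by (auto simp: even_subgraph_def)
  define path where "path p \<longleftrightarrow> distinct p \<and> 2 \<le> length p \<and>
    (\<forall>i. Suc i < length p \<longrightarrow> {p ! i, p ! Suc i} \<in> W)" for p
  have finU: "finite (\<Union>W)"
    using fin two by (metis card.infinite finite_Union zero_neq_numeral)
  have bound: "length p \<le> card (\<Union>W)" if "path p" for p
  proof -
    have "p ! i \<in> \<Union>W" if i: "i < length p" for i
    proof (cases i)
      case 0
      then show ?thesis using \<open>path p\<close> by (auto simp: path_def intro!: bexI[of _ "{p ! 0, p ! Suc 0}"])
    next
      case (Suc k)
      then show ?thesis
        using \<open>path p\<close> i by (auto simp: path_def intro!: bexI[of _ "{p ! k, p ! Suc k}"])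
    qed
    then have "set p \<subseteq> \<Union>W" by (auto simp: in_set_conv_nth)
    then show ?thesis
      using card_mono[OF finU] that by (metis distinct_card path_def)
  qed
  obtain e where "e \<in> W" using \<open>W \<noteq> {}\<close> by blast
  then obtain x y where xy: "x \<noteq> y" "{x, y} \<in> W" using two by (metis card_2_iff)
  then have "path [x, y]" by (auto simp: path_def)
  then obtain p where p: "path p" and max: "\<And>q. path q \<Longrightarrow> length q \<le> length p"
    using ex_has_greatest_nat[of path "[x, y]" length "Suc (card (\<Union>W))"] bound by (metis le_imp_less_Suc)
  \<comment> \<open>The bound \<^term>\<open>card (\<Union>W)\<close> on the length makes a longest path exist; \<open>h\<close> is the end at which it cannot be extended.\<close>
  define h where "h = p ! 0"
  have "distinct p" "Suc 0 < length p" "0 < length p" using p by (auto simp: path_def)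
  then have first: "{h, p ! 1} \<in> W" "h \<noteq> p ! 1"
    using p nth_eq_iff_index_eq[of p 0 "Suc 0"] by (auto simp: path_def h_def)
  obtain e where e: "e \<in> W" "h \<in> e" "e \<noteq> {h, p ! 1}"
  proof (rule ccontr)
    assume "\<not> thesis"
    then have "e \<in> W \<Longrightarrow> h \<in> e \<longleftrightarrow> e = {h, p ! 1}" for e using that by auto
    then have "vertex_degree W h = (\<Sum>e\<in>W. of_bool (e = {h, p ! 1}))"
      unfolding vertex_degree_def by (intro sum.cong) auto
    also have "\<dots> = 1"
    proof -
      have "W \<inter> {e. e = {h, p ! 1}} = {{h, p ! 1}}" using first by auto
      then show ?thesis using fin by simp
    qed
    finally show False using W by (metis even_subgraph_def odd_one)
  qed
  then obtain z where z: "e = {h, z}" "z \<noteq> h" "z \<noteq> p ! 1"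
    using two[OF e(1)] by (auto simp: card_2_iff)
  have "z \<in> set p"
  proof (rule ccontr)
    assume "z \<notin> set p"
    have "path (z # p)"
      unfolding path_def
    proof (intro conjI allI impI)
      fix i assume i: "Suc i < length (z # p)"
      show "{(z # p) ! i, (z # p) ! Suc i} \<in> W"
      proof (cases i)
        case 0
        then show ?thesis using e z by (simp add: h_def insert_commute)
      next
        case (Suc k)
        then show ?thesis using p i by (simp add: path_def)
      qed
    qed (use p \<open>z \<notin> set p\<close> in \<open>auto simp: path_def\<close>)
    then show False using max[of "z # p"] by simp
  qed
  then obtain k where k: "k < length p" "p ! k = z" by (auto simp: in_set_conv_nth)
  have "k \<noteq> 0" "k \<noteq> 1" using k(2) z(2,3) h_def by metis+
  then have k2: "2 \<le> k" by simp
  define c where "c = take (Suc k) p"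
  have len: "length c = Suc k" using k by (simp add: c_def)
  have nth: "c ! i = p ! i" if "i \<le> k" for i using that by (simp add: c_def)
  have "cycle_edges c \<subseteq> W"
  proof
    fix f assume "f \<in> cycle_edges c"
    then obtain i where i: "i \<le> k" "f = {c ! i, c ! (Suc i mod Suc k)}"
      by (auto simp: cycle_edges_def len less_Suc_eq_le)
    show "f \<in> W"
    proof (cases "i = k")
      case True
      then show ?thesis using i e z k nth by (simp add: h_def insert_commute)
    next
      case False
      then have "Suc i \<le> k" using i by simp
      then show ?thesis using i p k nth by (simp add: path_def)
    qed
  qed
  then have "is_cycle W c"
    using p k2 by (simp add: is_cycle_def len) (simp add: c_def path_def)
  then show thesis by (rule that)
qed

lemma even_subgraph_card_ge_3:
  assumes "even_subgraph C" "C \<noteq> {}"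
  shows "3 \<le> card C"
proof -
  obtain c where c: "is_cycle C c" using even_subgraph_contains_cycle[OF assms] .
  then have "3 \<le> card (cycle_edges c)" using card_cycle_edges[OF c] by (simp add: is_cycle_def)
  also have "\<dots> \<le> card C"
    using c assms by (intro card_mono) (auto simp: is_cycle_def even_subgraph_def)
  finally show ?thesis .
qed

lemma even_sum_consecutive:
  "i \<le> j \<Longrightarrow> even ((\<Sum>k=i..<j. f k + f (Suc k)) + f i + f j :: nat)"
  by (induction j rule: dec_induct) (auto simp: algebra_simps)

text \<open>The two arcs between the endpoints of the chord. Each of them has at least two edges because, with the
  chord added, it is a nonempty even subgraph of a simple graph.\<close>

lemma chord_splits_cycle:
  assumes c: "is_cycle E c" and e: "is_chord E c e" and two: "\<And>e. e \<in> E \<Longrightarrow> card e = 2"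
  obtains P Q where "P \<union> Q = cycle_edges c" "P \<inter> Q = {}" "2 \<le> card P" "2 \<le> card Q"
    "even_subgraph (insert e P)" "even_subgraph (insert e Q)"
proof -
  let ?D = "cycle_edges c"
  have dc: "distinct c" "3 \<le> length c" and DE: "?D \<subseteq> E" using c by (auto simp: is_cycle_def)
  have eE: "e \<in> E" and eD: "e \<notin> ?D" and "e \<subseteq> set c" using e by (auto simp: is_chord_def)
  obtain x y where xy: "e = {x, y}" "x \<noteq> y" using two[OF eE] by (auto simp: card_2_iff)
  then obtain i' j' where "i' < length c" "c ! i' = x" "j' < length c" "c ! j' = y"
    using \<open>e \<subseteq> set c\<close> by (auto simp: in_set_conv_nth)
  then obtain i j where ij: "i < j" "j < length c" "e = {c ! i, c ! j}" "c ! i \<noteq> c ! j"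
    using xy by (cases i' j' rule: linorder_cases) (auto simp: insert_commute)
  define P where "P = cycle_edge c ` {i..<j}"
  define Q where "Q = ?D - P"
  have PD: "P \<subseteq> ?D" using ij by (auto simp: P_def cycle_edges_image)
  have fin: "finite ?D" by (simp add: cycle_edges_image)
  then have finPQ: "finite P" "finite Q" using PD by (auto simp: Q_def intro: finite_subset)
  have degP: "even (vertex_degree P v + of_bool (v \<in> e))" for v
  proof -
    have "vertex_degree P v = (\<Sum>k=i..<j. of_bool (v \<in> cycle_edge c k))"
      unfolding vertex_degree_def P_def
      by (subst sum.reindex) (auto intro: inj_on_subset[OF inj_on_cycle_edge[OF dc]] simp: ij(2) o_def less_trans[OF _ ij(2)])
    also have "\<dots> = (\<Sum>k=i..<j. of_bool (v = c ! k) + of_bool (v = c ! Suc k))"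
    proof (rule sum.cong)
      fix k assume "k \<in> {i..<j}"
      then have "k < length c" "Suc k mod length c = Suc k" using ij by auto
      then show "(of_bool (v \<in> cycle_edge c k) :: nat) = of_bool (v = c ! k) + of_bool (v = c ! Suc k)"
        using cycle_edge_memb[OF dc, of k v] by simp
    qed simp
    finally have "vertex_degree P v + of_bool (v \<in> e) =
        (\<Sum>k=i..<j. of_bool (v = c ! k) + of_bool (v = c ! Suc k)) + of_bool (v = c ! i) + of_bool (v = c ! j)"
      using ij by auto
    then show ?thesis
      using even_sum_consecutive[of i j "\<lambda>k. of_bool (v = c ! k)"] ij by simp
  qed
  have degD: "vertex_degree ?D v = vertex_degree P v + vertex_degree Q v" for v
    using vertex_degree_Un[of P Q v] PD finPQ by (simp add: Q_def Un_absorb1)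
  have insert: "vertex_degree (insert e C) v = vertex_degree C v + of_bool (v \<in> e)"
    if "C \<subseteq> ?D" for C v
    using that eD finite_subset[OF that fin] by (subst vertex_degree_def, subst sum.insert)
      (auto simp: vertex_degree_def)
  have evD: "even_subgraph ?D" using even_subgraph_cycle[OF c two] .
  have evP: "even_subgraph (insert e P)"
    unfolding even_subgraph_def
    using finPQ degP PD DE eE two insert[OF PD] by auto
  have QD: "Q \<subseteq> ?D" by (auto simp: Q_def)
  have "even (vertex_degree Q v + of_bool (v \<in> e))" for v
    using degP[of v] degD[of v] evD unfolding even_subgraph_def by (metis even_add)
  then have evQ: "even_subgraph (insert e Q)"
    unfolding even_subgraph_def
    using finPQ QD DE eE two insert[OF QD] by auto
  have "e \<notin> P" "e \<notin> Q" using eD PD QD by auto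
  then have "2 \<le> card P" "2 \<le> card Q"
    using even_subgraph_card_ge_3[OF evP] even_subgraph_card_ge_3[OF evQ] finPQ by auto
  then show thesis
    using that[of P Q] evP evQ PD by (auto simp: Q_def)
qed


section \<open>Monomials in the edges of a graph\<close>

text \<open>The exponent vector of the squarefree monomial with support \<open>C\<close>.\<close>

definition edge_product :: "'a set set \<Rightarrow> ('a set \<Rightarrow>\<^sub>0 nat)" where
  "edge_product C = (\<Sum>e\<in>C. single e 1)"

lemma lookup_edge_product: "finite C \<Longrightarrow> lookup (edge_product C) e = of_bool (e \<in> C)"
  by (simp add: edge_product_def lookup_sum lookup_single when_def sum.delta)

lemma keys_edge_product: "finite C \<Longrightarrow> keys (edge_product C) = C"
  by (auto simp: in_keys_iff lookup_edge_product)

lemma monom_degree_edge_product: "monom_degree (edge_product C) = card C"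
  by (simp add: edge_product_def monom_degree_sum)

lemma lookup_endpoint_monomial_edge_product:
  assumes "\<And>e. e \<in> C \<Longrightarrow> finite e"
  shows "lookup (endpoint_monomial (edge_product C)) v = vertex_degree C v"
  unfolding edge_product_def endpoint_monomial_sum endpoint_monomial_single lookup_sum vertex_degree_def
  by (rule sum.cong) (use assms in \<open>simp_all add: lookup_single when_def sum.delta\<close>)

lemma monom_degree_endpoint_monomial:
  assumes "\<And>e. e \<in> keys a \<Longrightarrow> card e = 2"
  shows "monom_degree (endpoint_monomial a) = 2 * monom_degree a"
  using assms by (simp add: endpoint_monomial_def monom_degree_sum monom_degree_def[of a] sum_distrib_left)

lemma eulerian_equiv_refl: "keys a \<subseteq> E \<Longrightarrow> eulerian_equiv E a a"
  and eulerian_equiv_sym: "eulerian_equiv E a b \<Longrightarrow> eulerian_equiv E b a"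
  and eulerian_equiv_trans: "eulerian_equiv E a b \<Longrightarrow> eulerian_equiv E b c \<Longrightarrow> eulerian_equiv E a c"
  by (auto simp: eulerian_equiv_def intro: parity_equiv_refl parity_equiv_sym parity_equiv_trans)

lemma eulerian_equiv_cancel_left:
  "eulerian_equiv E (m + a) (m + b) \<longleftrightarrow> keys m \<subseteq> E \<and> eulerian_equiv E a b"
  by (auto simp: eulerian_equiv_def keys_add_nat endpoint_monomial_add)

lemma eulerian_equiv_degree:
  assumes "\<And>e. e \<in> E \<Longrightarrow> card e = 2" "eulerian_equiv E a b"
  shows "monom_degree a = monom_degree b"
proof -
  have "monom_degree (endpoint_monomial a) = 2 * monom_degree a"
    "monom_degree (endpoint_monomial b) = 2 * monom_degree b"
    using assms by (auto simp: eulerian_equiv_def intro!: monom_degree_endpoint_monomial)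
  then show ?thesis using assms(2) by (simp add: eulerian_equiv_def parity_equiv_def)
qed

lemma eulerian_equiv_squares:
  assumes "\<And>e. e \<in> E \<Longrightarrow> card e = 2" "e \<in> E" "f \<in> E"
  shows "eulerian_equiv E (single e 2) (single f 2)"
proof -
  have "even (lookup (endpoint_monomial (single g 2)) v)" for g :: "'a set" and v
    by (simp add: lookup_sum dvd_sum lookup_single when_def)
  then show ?thesis
    using assms monom_degree_endpoint_monomial[of "single e 2"] monom_degree_endpoint_monomial[of "single f 2"]
    by (simp add: eulerian_equiv_def parity_equiv_def)
qed

lemma eulerian_equiv_edge_products_iff:
  assumes two: "\<And>e. e \<in> E \<Longrightarrow> card e = 2" and sub: "A \<subseteq> E" "B \<subseteq> E"
    and fin: "finite A" "finite B" and disj: "A \<inter> B = {}"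
  shows "eulerian_equiv E (edge_product A) (edge_product B) \<longleftrightarrow> card A = card B \<and> even_subgraph (A \<union> B)"
proof -
  have fe: "finite e" if "e \<in> A \<union> B" for e
  proof -
    have "card e = 2" using two that sub by blast
    then show ?thesis by (metis card.infinite zero_neq_numeral)
  qed
  have deg: "monom_degree (endpoint_monomial (edge_product C)) = 2 * card C" if "C \<subseteq> E" "finite C" for C
    using that two by (subst monom_degree_endpoint_monomial)
      (auto simp: keys_edge_product monom_degree_edge_product)
  have look: "lookup (endpoint_monomial (edge_product C)) v = vertex_degree C v" if "C \<subseteq> A \<union> B" for C v
    using fe that by (intro lookup_endpoint_monomial_edge_product) auto
  have "even_subgraph (A \<union> B) \<longleftrightarrow> (\<forall>v. even (vertex_degree A v) \<longleftrightarrow> even (vertex_degree B v))"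
    using two sub fin by (auto simp: even_subgraph_def vertex_degree_Un[OF fin disj])
  then show ?thesis
    using sub fin by (auto simp: eulerian_equiv_def parity_equiv_def keys_edge_product deg look)
qed

lemma squarefree_eq_edge_product:
  assumes "\<And>e. lookup a e < 2"
  shows "a = edge_product (keys a)"
proof (rule poly_mapping_eqI)
  fix e show "lookup a e = lookup (edge_product (keys a)) e"
    using assms[of e] by (auto simp: lookup_edge_product in_keys_iff less_2_cases_iff)
qed


section \<open>Congruences containing all Eulerian binomials of low degree\<close>

text \<open>In the applications \<^term>\<open>R a b\<close> says that \<open>t\<^sup>a - t\<^sup>b\<close> lies in the ideal generated by the Eulerian
  binomials of degree at most \<open>N\<close>. The aim is to derive \<^term>\<open>R a b\<close> for all equivalent \<open>a\<close> and \<open>b\<close>,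
  by induction on their common degree \<open>d\<close>; the lemmas with the assumption \<open>smaller\<close> are its steps.\<close>

locale eulerian_congruence = monomial_congruence E R
  for V :: "'a set" and E :: "'a set set" and R :: "('a set \<Rightarrow>\<^sub>0 nat) \<Rightarrow> ('a set \<Rightarrow>\<^sub>0 nat) \<Rightarrow> bool" +
  fixes N :: nat
  assumes graph: "simple_graph V E"
    and low_degree: "eulerian_equiv E a b \<Longrightarrow> monom_degree a \<le> N \<Longrightarrow> R a b"
    and N: "2 \<le> N"
begin

lemmas card_edge = simple_graph_card_edge[OF graph]

lemma degree_eq: "eulerian_equiv E a b \<Longrightarrow> monom_degree a = monom_degree b"
  using eulerian_equiv_degree card_edge by blast

context
  fixes d :: nat
  assumes smaller: "\<forall>a b. eulerian_equiv E a b \<longrightarrow> monom_degree a < d \<longrightarrow> R a b"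
begin

lemma related_if_common_edge:
  assumes ab: "eulerian_equiv E a b" "monom_degree a = d" and e: "e \<in> keys a" "e \<in> keys b"
  shows "R a b"
proof -
  define a' b' where "a' = a - single e 1" and "b' = b - single e 1"
  have a: "a = single e 1 + a'" and b: "b = single e 1 + b'"
    using e by (simp_all add: a'_def b'_def single_plus_minus in_keys_iff)
  have "eulerian_equiv E a' b'"
    using ab(1) unfolding a b eulerian_equiv_cancel_left by simp
  moreover have "monom_degree a' < d" using ab(2) by (simp add: a monom_degree_add)
  ultimately have "R a' b'" using smaller by blast
  moreover have "e \<in> E" using e ab by (auto simp: eulerian_equiv_def)
  ultimately show ?thesis unfolding a b by (intro add_left) auto
qed

text \<open>The square is moved onto an edge of \<open>b\<close>, which is a quadratic move, and then this edge is common.\<close>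

lemma related_if_square:
  assumes ab: "eulerian_equiv E a b" "monom_degree a = d" and e: "2 \<le> lookup a e"
  shows "R a b"
proof -
  define a' where "a' = a - single e 2"
  have a: "a = a' + single e 2"
    using single_plus_minus[OF e] by (simp add: a'_def add.commute)
  have keys: "keys a \<subseteq> E" "keys b \<subseteq> E" using ab by (auto simp: eulerian_equiv_def)
  then have "keys a' \<subseteq> E" "e \<in> E" by (auto simp: a keys_add_nat)
  have "0 < monom_degree b" using degree_eq[OF ab(1), symmetric] by (simp only: a monom_degree_add) simp
  then obtain f where f: "f \<in> keys b" by (metis all_not_in_conv keys_eq_empty less_irrefl monom_degree_zero)
  then have "f \<in> E" using keys by blast
  have sq: "eulerian_equiv E (single e 2) (single f 2)"
    using card_edge \<open>e \<in> E\<close> \<open>f \<in> E\<close> by (intro eulerian_equiv_squares)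
  define c where "c = a' + single f 2"
  have "R a c"
    unfolding a c_def using N by (intro add_left low_degree sq \<open>keys a' \<subseteq> E\<close>) simp
  moreover have ac: "eulerian_equiv E a c"
    unfolding a c_def eulerian_equiv_cancel_left using sq \<open>keys a' \<subseteq> E\<close> by blast
  then have "eulerian_equiv E c b" using ab(1) by (blast intro: eulerian_equiv_sym eulerian_equiv_trans)
  moreover have "monom_degree c = d" using degree_eq[OF ac] ab by simp
  moreover have "f \<in> keys c" by (simp add: c_def keys_add_nat)
  ultimately show ?thesis
    using related_if_common_edge[of c b f] f rel_trans by blast
qed

text \<open>As \<open>C\<close> is even, \<open>H\<close> and its complement in \<open>C\<close> are equivalent squarefree monomials, and their degree is
  less than \<open>d\<close>.\<close>

lemma swap_half:
  assumes a: "keys a \<subseteq> E" "monom_degree a = d"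
    and C: "even_subgraph C" "C \<subseteq> E" and H: "H \<subseteq> C" "H \<subseteq> keys a" "2 * card H = card C" "card H < d"
  defines "a' \<equiv> edge_product (C - H) + (a - edge_product H)"
  shows "R a a'" "eulerian_equiv E a a'"
proof -
  have fin: "finite C" "finite H"
    using C(1) H(1) by (auto simp: even_subgraph_def intro: finite_subset)
  define r where "r = a - edge_product H"
  have r: "a = r + edge_product H"
    by (rule poly_mapping_eqI)
      (use H(2) fin in \<open>auto simp: r_def lookup_add lookup_minus lookup_edge_product in_keys_iff\<close>)
  have rE: "keys r \<subseteq> E" using a r by (auto simp: keys_add_nat)
  have card: "card (C - H) = card H"
    using H(1,3) fin by (simp add: card_Diff_subset)
  have "even_subgraph (H \<union> (C - H))" using C(1) H(1) by (simp add: Un_absorb1)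
  then have eq: "eulerian_equiv E (edge_product H) (edge_product (C - H))"
    using card C H(1) fin card_edge by (subst eulerian_equiv_edge_products_iff) auto
  then have "R (edge_product H) (edge_product (C - H))"
    using H(4) smaller by (simp add: monom_degree_edge_product)
  then have "R (r + edge_product H) (r + edge_product (C - H))"
    using rE by (rule add_left)
  then show "R a a'" unfolding a'_def r_def[symmetric] by (simp add: r[symmetric] add.commute)
  have "eulerian_equiv E (r + edge_product H) (r + edge_product (C - H))"
    unfolding eulerian_equiv_cancel_left using eq rE by blast
  then show "eulerian_equiv E a a'" unfolding a'_def r_def[symmetric] by (simp add: r[symmetric] add.commute)
qed

lemma move_onto_edge:
  assumes a: "keys a \<subseteq> E" "monom_degree a = d"
    and C: "even_subgraph C" "C \<subseteq> E" "card C = 2 * k" "k < d" "k \<le> card (C \<inter> keys a)" and e: "e \<in> C"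
  obtains a' where "R a a'" "eulerian_equiv E a a'" "e \<in> keys a'"
proof (cases "e \<in> keys a")
  case True
  then show thesis using that[of a] rel_refl eulerian_equiv_refl a by blast
next
  case False
  obtain H where H: "H \<subseteq> C \<inter> keys a" "card H = k" "finite H"
    using obtain_subset_with_card_n[OF C(5)] by blast
  have "finite C" using C(1) by (simp add: even_subgraph_def)
  have "e \<in> keys (edge_product (C - H) + (a - edge_product H))"
    using False e H(1) \<open>finite C\<close> by (auto simp: keys_add_nat keys_edge_product)
  moreover note swap_half[OF a C(1,2), of H]
  ultimately show thesis using that H C by auto
qed

end

text \<open>A monomial of degree greater than the number of edges is divisible by the square of an edge.\<close>

lemma related_if_card_le:
  assumes "card E \<le> N" "eulerian_equiv E a b"
  shows "R a b"
  using assms(2)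
proof (induction "monom_degree a" arbitrary: a b rule: less_induct)
  case less
  show ?case
  proof (cases "monom_degree a \<le> N")
    case True
    then show ?thesis using less.prems low_degree by blast
  next
    case False
    have "\<exists>e. 2 \<le> lookup a e"
    proof (rule ccontr)
      assume "\<not> ?thesis"
      then have "a = edge_product (keys a)" by (intro squarefree_eq_edge_product) (simp add: not_le)
      then have "monom_degree a = card (keys a)" by (metis monom_degree_edge_product)
      also have "\<dots> \<le> card E"
        using less.prems simple_graph_finite_edges[OF graph] by (intro card_mono) (auto simp: eulerian_equiv_def)
      finally show False using False assms(1) by simp
    qed
    moreover have "\<forall>a' b'. eulerian_equiv E a' b' \<longrightarrow> monom_degree a' < monom_degree a \<longrightarrow> R a' b'"
      using less.hyps by blast
    ultimately show ?thesis using related_if_square less.prems by blast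
  qed
qed

text \<open>A minimality argument replaces the decomposition of an even subgraph into edge-disjoint cycles:
  among the nonempty even subgraphs of \<open>A \<union> B\<close> with at least half of their edges in \<open>A\<close>, let \<open>W\<close>
  be a smallest one. A cycle in \<open>W\<close> has at least half of its edges in \<open>A\<close> as well, since otherwise its
  complement in \<open>W\<close> would do.
  For the chord \<open>g\<close> the count is as follows. Let \<open>X\<close> and \<open>Y\<close> be the arcs, with \<open>2 k\<^sub>1 - 1\<close> and
  \<open>2 k\<^sub>2 - 1\<close> edges. One of \<open>A\<close>, \<open>B\<close> has at least \<open>k\<^sub>1\<close> edges in \<open>X\<close>, so the other one has at most
  \<open>k\<^sub>1 - 1\<close> there, and hence at least \<open>d - k\<^sub>1 + 1 = k\<^sub>2\<close> edges in \<open>Y\<close>.\<close>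

lemma related_if_bipartite_chordal:
  assumes chordal: "bipartite_chordal V E" and "eulerian_equiv E a b"
  shows "R a b"
  using assms(2)
proof (induction "monom_degree a" arbitrary: a b rule: less_induct)
  case less
  define d where "d = monom_degree a"
  have IH: "\<forall>a' b'. eulerian_equiv E a' b' \<longrightarrow> monom_degree a' < d \<longrightarrow> R a' b'"
    using less.hyps by (simp add: d_def)
  note ab = less.prems
  have deg: "monom_degree a = d" "monom_degree b = d" using degree_eq[OF ab] by (simp_all add: d_def)
  have keysE: "keys a \<subseteq> E" "keys b \<subseteq> E" using ab by (auto simp: eulerian_equiv_def)
  have bip: "bipartite V E" using chordal by (simp add: bipartite_chordal_def)
  note common = related_if_common_edge[of d, OF IH]
  note square = related_if_square[of d, OF IH]
  note onto = move_onto_edge[of d, OF IH]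
  have even_card: "\<exists>k. card C = 2 * k" if "even_subgraph C" "C \<subseteq> E" for C
    using even_subgraph_even_card[OF bip simple_graph_finite_vertices[OF graph] that] by blast
  consider "monom_degree a \<le> N" | "keys a \<inter> keys b \<noteq> {}" | e where "2 \<le> lookup a e"
    | e where "2 \<le> lookup b e"
    | "N < d" "keys a \<inter> keys b = {}" "\<And>e. lookup a e < 2" "\<And>e. lookup b e < 2"
    using deg(1) by (metis not_le)
  then show ?case
  proof cases
    case 1
    then show ?thesis using ab low_degree by blast
  next
    case 2
    then show ?thesis using common ab deg by blast
  next
    case 3
    then show ?thesis using square ab deg by blast
  next
    case 4
    then have "R b a" using square[of b a] eulerian_equiv_sym[OF ab] deg by blast
    then show ?thesis by (rule rel_sym)
  next
    case 5
    define A B where "A = keys a" and "B = keys b"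
    have fin: "finite A" "finite B" and sub: "A \<subseteq> E" "B \<subseteq> E" and disj: "A \<inter> B = {}"
      using keysE 5(2) by (simp_all add: A_def B_def)
    have aA: "a = edge_product A" and bB: "b = edge_product B"
      using 5 by (auto simp: A_def B_def intro: squarefree_eq_edge_product)
    have cards: "card A = d" "card B = d"
      using deg aA bB monom_degree_edge_product by metis+
    have evenW: "even_subgraph (A \<union> B)"
      using ab eulerian_equiv_edge_products_iff[OF card_edge sub fin disj] aA bB by simp
    define P where "P W \<longleftrightarrow> W \<subseteq> A \<union> B \<and> W \<noteq> {} \<and> even_subgraph W \<and> card (B \<inter> W) \<le> card (A \<inter> W)" for W
    have "A \<noteq> {}" using cards 5(1) N fin by auto
    then have "P (A \<union> B)"
      using cards evenW by (auto simp: P_def Int_absorb2 Int_absorb1)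
    then obtain W where W: "P W" and min: "\<And>W'. P W' \<Longrightarrow> card W \<le> card W'"
      using ex_has_least_nat[of P "A \<union> B" card] by blast
    have finW: "finite W" using W fin by (auto simp: P_def intro: finite_subset)
    obtain c where c: "is_cycle W c"
      using W even_subgraph_contains_cycle by (metis P_def)
    define D where "D = cycle_edges c"
    have cE: "is_cycle E c" using c W sub by (auto simp: is_cycle_def P_def)
    have DW: "D \<subseteq> W" and evenD: "even_subgraph D" and cardD: "card D = length c"
      using c cE even_subgraph_cycle[OF cE card_edge] card_cycle_edges
      by (auto simp: D_def is_cycle_def)
    have D3: "3 \<le> card D" using c cardD by (simp add: is_cycle_def)
    have DAB: "D \<subseteq> A \<union> B" using DW W by (auto simp: P_def)
    have finD: "finite D" using DW finW finite_subset by blast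
    have DE: "D \<subseteq> E" using DAB sub by blast
    \<comment> \<open>Otherwise \<open>W - D\<close> would be a smaller subgraph with the same property as \<open>W\<close>.\<close>
    have D_half: "card (B \<inter> D) \<le> card (A \<inter> D)"
    proof (rule ccontr)
      assume less: "\<not> card (B \<inter> D) \<le> card (A \<inter> D)"
      have split: "card (X \<inter> W) = card (X \<inter> D) + card (X \<inter> (W - D))" for X
      proof -
        have "X \<inter> W = (X \<inter> D) \<union> (X \<inter> (W - D))" using DW by blast
        then show ?thesis using finW finD by (simp add: card_Un_disjoint Int_Diff disjoint_iff)
      qed
      have "card (B \<inter> (W - D)) < card (A \<inter> (W - D))"
        using W less split[of A] split[of B] by (simp add: P_def)
      moreover from this have "W - D \<noteq> {}" by (metis card.empty inf_bot_right not_less0)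
      moreover have "even_subgraph (W - D)" using even_subgraph_Diff[OF _ evenD DW] W by (simp add: P_def)
      ultimately have "P (W - D)" using W by (auto simp: P_def)
      then have "card W \<le> card (W - D)" by (rule min)
      moreover have "card (W - D) < card W"
        using card_Diff_subset[OF finD DW] card_mono[OF finW DW] D3 by simp
      ultimately show False by simp
    qed
    have cardDAB: "card D = card (A \<inter> D) + card (B \<inter> D)"
    proof -
      have "D = (A \<inter> D) \<union> (B \<inter> D)" using DAB by blast
      moreover have "(A \<inter> D) \<inter> (B \<inter> D) = {}" using disj by blast
      ultimately show ?thesis using finD card_Un_disjoint[of "A \<inter> D" "B \<inter> D"] by simp
    qed
    obtain k where k: "card D = 2 * k" using even_card[OF evenD DE] by blast
    have kA: "k \<le> card (D \<inter> A)" using D_half cardDAB k by (simp add: Int_commute)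
    show ?thesis
    proof (cases "k < d")
      case True
      show ?thesis
      proof (cases "D \<inter> B = {}")
        case False
        then obtain e where e: "e \<in> D" "e \<in> B" by blast
        obtain a' where a': "R a a'" "eulerian_equiv E a a'" "e \<in> keys a'"
          using onto[OF keysE(1) deg(1) evenD DE k True, of e] kA e(1) unfolding A_def by blast
        have "eulerian_equiv E a' b" using a'(2) ab by (blast intro: eulerian_equiv_sym eulerian_equiv_trans)
        then have "R a' b"
          using common[of a' b e] a'(3) e(2) degree_eq[OF a'(2)] deg(1) by (simp add: B_def)
        then show ?thesis using a'(1) rel_trans by blast
      next
        case True
        then have "D \<subseteq> A" using DAB by blast
        obtain H where H: "H \<subseteq> D" "card H = k" using kA by (metis obtain_subset_with_card_n inf.boundedE)
        define a' where "a' = edge_product (D - H) + (a - edge_product H)"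
        have a': "R a a'" "eulerian_equiv E a a'"
          unfolding a'_def using swap_half[of d, OF IH keysE(1) deg(1) evenD DE, of H] H k \<open>k < d\<close> \<open>D \<subseteq> A\<close>
          by (auto simp: A_def)
        \<comment> \<open>An edge of \<open>D\<close> outside \<open>H\<close> keeps its exponent 1 from \<open>a\<close> and gains another 1 in \<open>a'\<close>.\<close>
        have "card H < card D" using H k D3 by simp
        then obtain e where e: "e \<in> D" "e \<notin> H" using H(1) by (metis less_irrefl subsetI subset_antisym)
        have "finite H" using H(1) finD finite_subset by blast
        then have "2 \<le> lookup a' e"
          using e \<open>D \<subseteq> A\<close> finD fin by (auto simp: a'_def aA lookup_add lookup_minus lookup_edge_product)
        moreover have "eulerian_equiv E a' b" using a'(2) ab by (blast intro: eulerian_equiv_sym eulerian_equiv_trans)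
        ultimately have "R a' b" using square[of a' b e] degree_eq[OF a'(2)] deg(1) by simp
        then show ?thesis using a'(1) rel_trans by blast
      qed
    next
      case False
      have "card (A \<inter> D) \<le> d" "card (B \<inter> D) \<le> d"
        using cards fin by (metis card_mono inf_le1)+
      then have kd: "k = d" "card (A \<inter> D) = d" "card (B \<inter> D) = d"
        using False cardDAB k D_half by linarith+
      then have "4 < length c" using cardD k 5(1) N by simp
      then obtain g where g: "is_chord E c g"
        using chordal cE by (auto simp: bipartite_chordal_def)
      obtain X Y where XY: "X \<union> Y = D" "X \<inter> Y = {}" "2 \<le> card X" "2 \<le> card Y"
        "even_subgraph (insert g X)" "even_subgraph (insert g Y)"
        using chord_splits_cycle[OF cE g card_edge] unfolding D_def by blast
      have "g \<in> E" "g \<notin> D" using g by (auto simp: is_chord_def D_def)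
      have finXY: "finite X" "finite Y" using XY(1) finD by auto
      have XYE: "insert g X \<subseteq> E" "insert g Y \<subseteq> E" using XY(1) DE \<open>g \<in> E\<close> by auto
      obtain k1 where k1: "card (insert g X) = 2 * k1" using even_card[OF XY(5) XYE(1)] by blast
      obtain k2 where k2: "card (insert g Y) = 2 * k2" using even_card[OF XY(6) XYE(2)] by blast
      have cX: "card X + 1 = 2 * k1" and cY: "card Y + 1 = 2 * k2"
        using k1 k2 finXY \<open>g \<notin> D\<close> XY(1) by auto
      have cXY: "card X + card Y = 2 * d"
        using card_Un_disjoint[OF finXY XY(2)] XY(1) k kd by simp
      have small: "k1 < d" "k2 < d" using cX cY cXY XY(3,4) by linarith+
      have parts: "card (S \<inter> X) + card (S \<inter> Y) = card (S \<inter> D)" for S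
      proof -
        have "S \<inter> D = (S \<inter> X) \<union> (S \<inter> Y)" "(S \<inter> X) \<inter> (S \<inter> Y) = {}" using XY(1,2) by auto
        then show ?thesis using finXY card_Un_disjoint[of "S \<inter> X" "S \<inter> Y"] by simp
      qed
      have Xparts: "card (A \<inter> X) + card (B \<inter> X) = card X"
      proof -
        have "X = (A \<inter> X) \<union> (B \<inter> X)" "(A \<inter> X) \<inter> (B \<inter> X) = {}" using XY(1) DAB disj by auto
        then show ?thesis using finXY card_Un_disjoint[of "A \<inter> X" "B \<inter> X"] by simp
      qed
      \<comment> \<open>Both monomials can be moved onto \<open>g\<close>, using a different part of the cycle for each.\<close>
      have meet: "R a b"
        if h: "even_subgraph C" "C \<subseteq> E" "card C = 2 * i" "i < d" "i \<le> card (C \<inter> A)"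
          "even_subgraph C'" "C' \<subseteq> E" "card C' = 2 * j" "j < d" "j \<le> card (C' \<inter> B)"
          "g \<in> C" "g \<in> C'" for C C' i j
      proof -
        obtain a' where a': "R a a'" "eulerian_equiv E a a'" "g \<in> keys a'"
          using onto[OF keysE(1) deg(1) h(1-4) _ h(11)] h(5) unfolding A_def by blast
        obtain b' where b': "R b b'" "eulerian_equiv E b b'" "g \<in> keys b'"
          using onto[OF keysE(2) deg(2) h(6-9) _ h(12)] h(10) unfolding B_def by blast
        have "eulerian_equiv E a' b'"
          using a'(2) b'(2) ab by (blast intro: eulerian_equiv_sym eulerian_equiv_trans)
        then have "R a' b'"
          using common[of a' b' g] a'(3) b'(3) degree_eq[OF a'(2)] deg(1) by simp
        then show ?thesis using a'(1) b'(1) rel_trans rel_sym by blast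
      qed
      have ins: "card (S \<inter> C) \<le> card (insert g C \<inter> S)" if "finite C" for S C
        using that by (intro card_mono) auto
      have "k1 \<le> card (insert g X \<inter> A) \<and> k2 \<le> card (insert g Y \<inter> B) \<or>
          k1 \<le> card (insert g X \<inter> B) \<and> k2 \<le> card (insert g Y \<inter> A)"
        using cX cY cXY Xparts parts[of A] parts[of B] kd
          ins[OF finXY(1), of A] ins[OF finXY(1), of B] ins[OF finXY(2), of A] ins[OF finXY(2), of B]
        by linarith
      then show ?thesis
        using meet[OF XY(5) XYE(1) k1 small(1) _ XY(6) XYE(2) k2 small(2)]
          meet[OF XY(6) XYE(2) k2 small(2) _ XY(5) XYE(1) k1 small(1)] by blast
    qed
  qed
qed

end


section \<open>Generators of the Eulerian ideal\<close>

definition eulerian_binomials :: "'a set set \<Rightarrow> nat \<Rightarrow> ('a set, 'k::field) mpoly set" where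
  "eulerian_binomials E N =
     {single a 1 - single b 1 | a b. eulerian_equiv E a b \<and> monom_degree a \<le> N}"

context
  fixes V :: "'a set" and E :: "'a set set"
  assumes graph: "simple_graph V E"
begin

lemmas edges_in_V = simple_graph_edges_in_vertices[OF graph]
  and card_edge = simple_graph_card_edge[OF graph]
  and finite_edges = simple_graph_finite_edges[OF graph]

lemma eulerian_binomials_subset_ideal:
  "eulerian_binomials E N \<subseteq> (eulerian_ideal V E :: ('a set, 'k::field) mpoly set)"
  using eulerian_equiv_binomial[OF edges_in_V] by (auto simp: eulerian_binomials_def)

lemma eulerian_binomials_closed:
  "eulerian_binomials E N \<subseteq> carrier (mpoly_ring E :: ('a set, 'k::field) mpoly ring)"
  using eulerian_binomials_subset_ideal by (auto simp: eulerian_ideal_def)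

lemma finite_eulerian_binomials:
  "finite (eulerian_binomials E N :: ('a set, 'k::field) mpoly set)"
proof -
  let ?M = "{m :: 'a set \<Rightarrow>\<^sub>0 nat. keys m \<subseteq> E \<and> monom_degree m \<le> N}"
  have "eulerian_binomials E N \<subseteq> (\<lambda>(a, b). single a 1 - single b 1 :: ('a set, 'k) mpoly) ` (?M \<times> ?M)"
  proof
    fix f :: "('a set, 'k) mpoly" assume "f \<in> eulerian_binomials E N"
    then obtain a b where ab: "f = single a 1 - single b 1" "eulerian_equiv E a b" "monom_degree a \<le> N"
      by (auto simp: eulerian_binomials_def)
    then have "(a, b) \<in> ?M \<times> ?M"
      using eulerian_equiv_degree[OF card_edge ab(2)] by (auto simp: eulerian_equiv_def)
    then show "f \<in> (\<lambda>(a, b). single a 1 - single b 1) ` (?M \<times> ?M)"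
      using ab(1) by (intro image_eqI[of _ _ "(a, b)"]) auto
  qed
  then show ?thesis
    by (rule finite_subset)
      (intro finite_imageI finite_cartesian_product finite_monomials_of_bounded_degree finite_edges)
qed

lemma keys_binomial: "keys (single a 1 - single b 1 :: ('a set, 'k::field) mpoly) \<subseteq> {a, b}"
  by (auto simp: in_keys_iff lookup_minus lookup_single when_def split: if_splits)

lemma eulerian_binomial_homogeneous:
  fixes f :: "('a set, 'k::field) mpoly"
  assumes "f \<in> eulerian_binomials E N"
  shows "mpoly_homogeneous f" "mpoly_degree f \<le> N"
proof -
  obtain a b where ab: "f = single a 1 - single b 1" "eulerian_equiv E a b" "monom_degree a \<le> N"
    using assms by (auto simp: eulerian_binomials_def)
  have deg: "monom_degree m = monom_degree a" if "m \<in> keys f" for m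
    using that keys_binomial[of a b] eulerian_equiv_degree[OF card_edge ab(2)] ab(1) by auto
  then show "mpoly_homogeneous f" by (auto simp: mpoly_homogeneous_def)
  show "mpoly_degree f \<le> N" using deg ab(3) by (simp add: mpoly_degree_def)
qed

text \<open>Both halves of the final equivalence start from here: \<open>N = 2\<close> for bipartite chordal graphs, and
  \<open>N = |E|\<close> for the existence of a minimal generating set in general.\<close>

lemma genideal_eulerian_binomials:
  assumes "2 \<le> N" and "card E \<le> N \<or> bipartite_chordal V E"
  shows "genideal (mpoly_ring E) (eulerian_binomials E N) =
    (eulerian_ideal V E :: ('a set, 'k::field) mpoly set)"
proof
  let ?G = "genideal (mpoly_ring E) (eulerian_binomials E N) :: ('a set, 'k) mpoly set"
  show "?G \<subseteq> eulerian_ideal V E"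
    by (intro genideal_mpoly_least eulerian_ideal_ideal edges_in_V eulerian_binomials_subset_ideal)
  have G: "ideal ?G (mpoly_ring E)"
    by (intro genideal_mpoly_ideal eulerian_binomials_closed)
  interpret monomial_congruence E "\<lambda>a b. single a 1 - single b 1 \<in> ?G"
    by (rule binomial_congruence[OF G])
  interpret eulerian_congruence V E "\<lambda>a b. single a 1 - single b 1 \<in> ?G" N
  proof
    show "single a 1 - single b 1 \<in> ?G" if "eulerian_equiv E a b" "monom_degree a \<le> N" for a b
      using that genideal_mpoly_superset[OF eulerian_binomials_closed, of N]
      by (auto simp: eulerian_binomials_def)
  qed (use graph assms in auto)
  show "eulerian_ideal V E \<subseteq> ?G"
    by (rule eulerian_ideal_least[OF G])
      (use assms(2) related_if_card_le related_if_bipartite_chordal in blast)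
qed

lemma eulerian_equiv_degree_le_1:
  assumes eq: "eulerian_equiv E a b" and deg: "monom_degree a \<le> 1"
  shows "a = b"
proof (cases "monom_degree a = 0")
  case True
  then show ?thesis using eulerian_equiv_degree[OF card_edge eq] by (metis monom_degree_eq_0_iff)
next
  case False
  have single: "\<exists>e. m = single e 1" if "monom_degree m = 1" for m :: "'a set \<Rightarrow>\<^sub>0 nat"
  proof -
    have "m \<noteq> 0" using that by auto
    then obtain e where "e \<in> keys m" by (metis all_not_in_conv keys_eq_empty)
    then have m: "m = single e 1 + (m - single e 1)" by (simp add: single_plus_minus in_keys_iff)
    then have "monom_degree (m - single e 1) = 0"
      using that monom_degree_add[of "single e 1" "m - single e 1"] by simp
    then show ?thesis using m by (metis add.right_neutral monom_degree_eq_0_iff)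
  qed
  have "monom_degree a = 1" "monom_degree b = 1"
    using False deg eulerian_equiv_degree[OF card_edge eq] by linarith+
  then obtain e f where ef: "a = single e 1" "b = single f 1" using single by metis
  have "e \<in> E" "f \<in> E" using eq by (auto simp: ef eulerian_equiv_def)
  then have "finite e" "finite f" using card_edge by (metis card.infinite zero_neq_numeral)+
  have "v \<in> e \<longleftrightarrow> v \<in> f" for v
  proof -
    have "even (lookup (endpoint_monomial a) v) \<longleftrightarrow> even (lookup (endpoint_monomial b) v)"
      using eq by (simp add: eulerian_equiv_def parity_equiv_def)
    then show ?thesis
      using \<open>finite e\<close> \<open>finite f\<close> by (simp add: ef lookup_sum lookup_single when_def sum.delta split: if_splits)
  qed
  then have "e = f" by blast
  then show ?thesis using ef by simp
qed

lemma eulerian_binomial_degree_2: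
  fixes f :: "('a set, 'k::field) mpoly"
  assumes "f \<in> eulerian_binomials E 2" "f \<noteq> 0"
  shows "mpoly_degree f = 2"
proof -
  obtain a b where ab: "f = single a 1 - single b 1" "eulerian_equiv E a b" "monom_degree a \<le> 2"
    using assms by (auto simp: eulerian_binomials_def)
  have "a \<noteq> b" using ab(1) assms(2) by auto
  then have "monom_degree a = 2" using eulerian_equiv_degree_le_1[OF ab(2)] ab(3) by linarith
  then show ?thesis
    using keys_binomial[of a b] eulerian_equiv_degree[OF card_edge ab(2)] ab(1) assms(2)
    by (intro mpoly_degree_eqI) auto
qed

lemma eulerian_ideal_nontrivial:
  assumes "2 \<le> card E"
  shows "\<exists>f. f \<in> (eulerian_ideal V E :: ('a set, 'k::field) mpoly set) \<and> f \<noteq> 0"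
proof -
  obtain e f where ef: "e \<in> E" "f \<in> E" "e \<noteq> f"
    using assms by (metis card_le_Suc0_iff_eq finite_edges not_less_eq_eq numeral_2_eq_2)
  have "eulerian_equiv E (single e 2) (single f 2)"
    using card_edge ef by (intro eulerian_equiv_squares)
  then have "single (single e 2) 1 - single (single f 2) 1 \<in> (eulerian_ideal V E :: ('a set, 'k) mpoly set)"
    by (rule eulerian_equiv_binomial[OF edges_in_V])
  moreover have "lookup (single (single e 2) 1 - single (single f 2) 1 :: ('a set, 'k) mpoly) (single e 2) = 1"
  proof -
    have "single f 2 \<noteq> (single e 2 :: 'a set \<Rightarrow>\<^sub>0 nat)"
      using ef by (metis keys_single singleton_inject zero_neq_numeral)
    then show ?thesis by (simp add: lookup_minus lookup_single when_def)
  qed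
  ultimately show ?thesis by (metis lookup_zero zero_neq_one)
qed

end


section \<open>A chordless cycle obstructs generation in degree two\<close>

lemma cycle_edge_mem_iff:
  assumes "distinct c" "i < length c" "k < length c"
  shows "c ! (Suc i mod length c) \<in> cycle_edge c k \<longleftrightarrow> k = i \<or> k = Suc i mod length c"
proof -
  have L: "0 < length c" using assms(2) by linarith
  then have "Suc i mod length c < length c" "Suc k mod length c < length c" by simp_all
  moreover have "Suc i mod length c = Suc k mod length c \<longleftrightarrow> k = i"
    using assms(2,3) by (auto simp: mod_Suc split: if_splits)
  ultimately show ?thesis
    using assms by (auto simp: cycle_edge_def nth_eq_iff_index_eq)
qed

text \<open>An edge of \<open>F\<close> forces the next edge of the cycle into \<open>F\<close>, because the vertex between them lies on no
  other edge of the cycle.\<close>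

lemma even_subgraph_of_cycle:
  assumes c: "distinct c" "3 \<le> length c"
    and F: "even_subgraph F" "F \<subseteq> cycle_edges c" "F \<noteq> {}"
  shows "F = cycle_edges c"
proof -
  let ?L = "length c"
  have L: "0 < ?L" using c by linarith
  have step: "cycle_edge c (Suc i mod ?L) \<in> F" if i: "i < ?L" "cycle_edge c i \<in> F" for i
  proof (rule ccontr)
    assume no: "cycle_edge c (Suc i mod ?L) \<notin> F"
    let ?v = "c ! (Suc i mod ?L)"
    have "F \<inter> {e. ?v \<in> e} = {cycle_edge c i}"
    proof
      show "F \<inter> {e. ?v \<in> e} \<subseteq> {cycle_edge c i}"
        using F(2) no cycle_edge_mem_iff[OF c(1) i(1)] by (auto simp: cycle_edges_image)
    qed (use i in \<open>auto simp: cycle_edge_def\<close>)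
    then have "vertex_degree F ?v = 1" using F(1) by (simp add: vertex_degree_def even_subgraph_def)
    then show False using F(1) by (metis even_subgraph_def odd_one)
  qed
  obtain i where i: "i < ?L" "cycle_edge c i \<in> F"
    using F(2,3) by (auto simp: cycle_edges_image)
  have all: "cycle_edge c ((i + n) mod ?L) \<in> F" for n
  proof (induction n)
    case (Suc n)
    have "cycle_edge c (Suc ((i + n) mod ?L) mod ?L) \<in> F"
      using Suc L by (intro step) simp_all
    then show ?case by (simp add: mod_Suc_eq)
  qed (use i in simp)
  have "cycle_edge c k \<in> F" if "k < ?L" for k
  proof -
    have "(i + (?L - i + k)) mod ?L = k" using that i by simp
    then show ?thesis using all[of "?L - i + k"] by simp
  qed
  then show ?thesis using F(2) by (auto simp: cycle_edges_image)
qed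

text \<open>Let \<open>b = t\<^sub>g t\<^sub>h\<close>. The four vertices of \<open>e \<union> f\<close> have odd degree in \<open>t\<^sub>g t\<^sub>h\<close>, so \<open>g \<union> h = e \<union> f\<close>,
  and the absence of chords makes \<open>g\<close> and \<open>h\<close> edges of the cycle. If they differed from \<open>e\<close> and \<open>f\<close>, the
  four edges would be an even subgraph of the cycle, hence the whole cycle, which is longer than 4.\<close>

lemma chordless_cycle_quadrics_isolated:
  assumes graph: "simple_graph V E" and c: "is_cycle E c" "4 < length c" "\<nexists>e. is_chord E c e"
    and ef: "e \<in> cycle_edges c" "f \<in> cycle_edges c" "e \<inter> f = {}"
    and eq: "eulerian_equiv E (edge_product {e, f}) b"
  shows "b = edge_product {e, f}"
proof (rule ccontr)
  assume neq: "b \<noteq> edge_product {e, f}"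
  note two = card_edge[OF graph]
  have DE: "cycle_edges c \<subseteq> E" using c(1) by (simp add: is_cycle_def)
  have efE: "e \<in> E" "f \<in> E" using ef DE by auto
  then have e2: "card e = 2" "card f = 2" using two by auto
  then have fin: "finite e" "finite f" by (metis card.infinite zero_neq_numeral)+
  have "e \<noteq> f" using ef(3) e2 by auto
  have bE: "keys b \<subseteq> E" using eq by (simp add: eulerian_equiv_def)
  have degb: "monom_degree b = 2"
    using eulerian_equiv_degree[OF two eq] \<open>e \<noteq> f\<close> by (simp add: monom_degree_edge_product)
  then have "b \<noteq> 0" by auto
  then obtain g where g: "g \<in> keys b" by (metis all_not_in_conv keys_eq_empty)
  define b' where "b' = b - single g 1"
  have b: "b = single g 1 + b'"
    using g by (simp add: b'_def single_plus_minus in_keys_iff)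
  then have degb': "monom_degree b' = 1" using degb monom_degree_add[of "single g 1" b'] by simp
  then have "b' \<noteq> 0" by auto
  then obtain h where h: "h \<in> keys b'" by (metis all_not_in_conv keys_eq_empty)
  have "b' = single h 1 + (b' - single h 1)"
    using h by (simp add: single_plus_minus in_keys_iff)
  moreover have "b' - single h 1 = 0"
    using calculation degb' monom_degree_add[of "single h 1" "b' - single h 1"] by simp
  ultimately have b: "b = single g 1 + single h 1" using b by simp
  have ghE: "g \<in> E" "h \<in> E" using bE b by (auto simp: keys_add_nat)
  have gh2: "card g = 2" "card h = 2" using two ghE by auto
  then have fin': "finite g" "finite h" by (metis card.infinite zero_neq_numeral)+
  have a: "edge_product {e, f} = single e 1 + single f 1"
    using \<open>e \<noteq> f\<close> by (simp add: edge_product_def)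
  have par: "even ((of_bool (v \<in> e) + of_bool (v \<in> f)) + (of_bool (v \<in> g) + of_bool (v \<in> h) :: nat))" for v
  proof -
    have look: "lookup (endpoint_monomial (single x 1)) v = of_bool (v \<in> x)" if "finite x" for x :: "'a set"
      using that by (simp add: lookup_sum lookup_single when_def sum.delta)
    have "even (lookup (endpoint_monomial (edge_product {e, f})) v) = even (lookup (endpoint_monomial b) v)"
      using eq by (simp add: eulerian_equiv_def parity_equiv_def)
    then show ?thesis
      unfolding a b endpoint_monomial_add lookup_add look[OF fin(1)] look[OF fin(2)]
        look[OF fin'(1)] look[OF fin'(2)] by (simp only: even_add)
  qed
  have "e \<union> f \<subseteq> g \<union> h"
  proof
    fix v assume "v \<in> e \<union> f"
    then show "v \<in> g \<union> h" using par[of v] ef(3) by (auto split: if_splits)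
  qed
  moreover have "card (e \<union> f) = 4" using fin ef(3) e2 by (simp add: card_Un_disjoint)
  moreover have "card (g \<union> h) \<le> 4" using card_Un_le[of g h] gh2 by simp
  ultimately have un: "g \<union> h = e \<union> f" using fin' card_seteq[of "g \<union> h" "e \<union> f"] by simp
  have "e \<subseteq> set c" "f \<subseteq> set c"
    using ef(1,2) c(2) by (auto simp: cycle_edges_def intro!: nth_mem mod_less_divisor)
  then have "g \<subseteq> set c" "h \<subseteq> set c" using un by auto
  then have ghD: "g \<in> cycle_edges c" "h \<in> cycle_edges c"
    using c(3) ghE by (auto simp: is_chord_def)
  have "g \<noteq> h" using un gh2 \<open>card (e \<union> f) = 4\<close> by auto
  have bgh: "b = edge_product {g, h}" using \<open>g \<noteq> h\<close> by (simp add: b edge_product_def)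
  have disj: "{e, f} \<inter> {g, h} = {}"
  proof (rule ccontr)
    assume "{e, f} \<inter> {g, h} \<noteq> {}"
    moreover have "g \<inter> h = {}"
      using card_Un_Int[OF fin'] gh2 un \<open>card (e \<union> f) = 4\<close> fin' by auto
    ultimately have "{g, h} = {e, f}" using un ef(3) by auto
    then show False using neq bgh by simp
  qed
  have "even_subgraph ({e, f} \<union> {g, h})"
    using eq eulerian_equiv_edge_products_iff[OF two _ _ _ _ disj] efE ghE by (simp add: bgh)
  then have "{e, f} \<union> {g, h} = cycle_edges c"
    using c(1) ef ghD by (intro even_subgraph_of_cycle) (auto simp: is_cycle_def)
  then have "length c = card ({e, f} \<union> {g, h})" using card_cycle_edges[OF c(1)] by simp
  also have "\<dots> \<le> 4" by (rule order_trans[OF card_Un_le]) (simp add: card_insert_if)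
  finally show False using c(2) by simp
qed

lemma chordless_cycle_not_generated_by_quadrics:
  fixes S :: "('a set, 'k::field) mpoly set"
  assumes graph: "simple_graph V E" and bip: "bipartite V E"
    and c: "is_cycle E c" "4 < length c" "\<nexists>e. is_chord E c e"
    and S: "S \<subseteq> carrier (mpoly_ring E)" "\<And>f. f \<in> S \<Longrightarrow> mpoly_degree f \<le> 2"
  shows "genideal (mpoly_ring E) S \<noteq> eulerian_ideal V E"
proof
  assume gen: "genideal (mpoly_ring E) S = eulerian_ideal V E"
  note two = card_edge[OF graph]
  let ?L = "length c"
  have dc: "distinct c" "3 \<le> ?L" and DE: "cycle_edges c \<subseteq> E" using c by (auto simp: is_cycle_def)
  have evenD: "even_subgraph (cycle_edges c)" using even_subgraph_cycle[OF c(1) two] .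
  have "even ?L"
    using even_subgraph_even_card[OF bip simple_graph_finite_vertices[OF graph] evenD DE] card_cycle_edges[OF c(1)] by simp
  then obtain m where m: "?L = 2 * m" by blast
  define A where "A = cycle_edge c ` (\<lambda>j. 2 * j) ` {..<m}"
  define B where "B = cycle_edge c ` (\<lambda>j. Suc (2 * j)) ` {..<m}"
  have sub: "(\<lambda>j. 2 * j) ` {..<m} \<subseteq> {..<?L}" "(\<lambda>j. Suc (2 * j)) ` {..<m} \<subseteq> {..<?L}"
    using m by auto
  have split: "(\<lambda>j. 2 * j) ` {..<m} \<union> (\<lambda>j. Suc (2 * j)) ` {..<m} = {..<?L}"
  proof
    show "{..<?L} \<subseteq> (\<lambda>j. 2 * j) ` {..<m} \<union> (\<lambda>j. Suc (2 * j)) ` {..<m}"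
    proof
      fix i assume "i \<in> {..<?L}"
      then show "i \<in> (\<lambda>j. 2 * j) ` {..<m} \<union> (\<lambda>j. Suc (2 * j)) ` {..<m}"
        using m by (cases "even i") (auto elim!: evenE oddE)
    qed
  qed (use sub in blast)
  have inj: "inj_on (cycle_edge c) {..<?L}" by (rule inj_on_cycle_edge[OF dc])
  have AB: "A \<union> B = cycle_edges c"
    unfolding A_def B_def cycle_edges_image split[symmetric] by (simp add: image_Un)
  have parity: "(\<lambda>j. 2 * j) ` {..<m} \<inter> (\<lambda>j. Suc (2 * j)) ` {..<m} = {}"
    by (auto, presburger)
  have disj: "A \<inter> B = {}"
    unfolding A_def B_def using inj_on_image_Int[OF inj sub] parity by simp
  have cards: "card A = m" "card B = m"
    unfolding A_def B_def
    using inj_on_subset[OF inj sub(1)] inj_on_subset[OF inj sub(2)]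
    by (simp_all add: card_image inj_on_def)
  have fin: "finite A" "finite B" by (simp_all add: A_def B_def)
  have ABE: "A \<subseteq> E" "B \<subseteq> E" using AB DE by auto
  have "eulerian_equiv E (edge_product A) (edge_product B)"
    using eulerian_equiv_edge_products_iff[OF two ABE fin disj] cards AB evenD by simp
  then have binomial: "single (edge_product A) 1 - single (edge_product B) 1 \<in> genideal (mpoly_ring E) S"
    unfolding gen by (rule eulerian_equiv_binomial[OF edges_in_V[OF graph]])
  have matching: "e \<inter> f = {}" if ef: "e \<in> A" "f \<in> A" "e \<noteq> f" for e f
  proof -
    obtain i j where ij: "i < m" "j < m" "e = cycle_edge c (2 * i)" "f = cycle_edge c (2 * j)"
      using ef by (auto simp: A_def)
    have "i \<noteq> j" using ij ef by auto
    have less: "2 * i < ?L" "Suc (2 * i) < ?L" "2 * j < ?L" "Suc (2 * j) < ?L" using ij m by auto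
    have ne: "2 * i \<noteq> 2 * j" "2 * i \<noteq> Suc (2 * j)" "Suc (2 * i) \<noteq> 2 * j" "Suc (2 * i) \<noteq> Suc (2 * j)"
      using \<open>i \<noteq> j\<close> by presburger+
    show ?thesis
      using less ne dc(1) by (simp add: ij cycle_edge_def nth_eq_iff_index_eq)
  qed
  have isolated: "b = edge_product T"
    if T: "T \<subseteq> A" "card T \<le> 2" and eq: "eulerian_equiv E (edge_product T) b" for T b
  proof (cases "card T = 2")
    case True
    then obtain e f where ef: "T = {e, f}" "e \<noteq> f" by (auto simp: card_2_iff)
    then have "e \<in> cycle_edges c" "f \<in> cycle_edges c" "e \<inter> f = {}" using T AB matching by auto
    then show ?thesis
      using chordless_cycle_quadrics_isolated[OF graph c] eq by (simp add: ef)
  next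
    case False
    then show ?thesis
      using eulerian_equiv_degree_le_1[OF graph eq] T by (simp add: monom_degree_edge_product)
  qed
  \<comment> \<open>The ideal spanned by the monomials that do not divide \<open>t\<^sup>A\<close>.\<close>
  define X :: "('a set, 'k) mpoly set" where
    "X = {p \<in> carrier (mpoly_ring E). \<forall>T\<subseteq>A. lookup p (edge_product T) = 0}"
  have "ideal X (mpoly_ring E)"
  proof (rule mpoly_idealI)
    fix w :: "'a set \<Rightarrow>\<^sub>0 nat" and k :: 'k and p assume w: "keys w \<subseteq> E" and p: "p \<in> X"
    \<comment> \<open>A divisor of a monomial dividing \<open>t\<^sup>A\<close> divides \<open>t\<^sup>A\<close>, and is therefore squarefree with support in \<open>A\<close>.\<close>
    have "lookup (single w k * p) (edge_product T) = 0" if "T \<subseteq> A" for T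
    proof (rule ccontr)
      assume "lookup (single w k * p) (edge_product T) \<noteq> 0"
      then have "edge_product T \<in> keys (single w k * p)" by (simp add: in_keys_iff)
      then obtain u where u: "edge_product T = w + u" "u \<in> keys p"
        using keys_monomial_mult[of w k p] by blast
      have finT: "finite T" using that fin finite_subset by blast
      have le: "lookup u x \<le> of_bool (x \<in> T)" for x
        using arg_cong[OF u(1), of "\<lambda>m. lookup m x"] by (simp add: lookup_add lookup_edge_product[OF finT])
      have "lookup u x < 2" for x using le[of x] by (cases "x \<in> T") simp_all
      then have "u = edge_product (keys u)" by (rule squarefree_eq_edge_product)
      moreover have "keys u \<subseteq> A"
      proof
        fix x assume "x \<in> keys u"
        then show "x \<in> A" using le[of x] that by (cases "x \<in> T") (auto simp: in_keys_iff)
      qed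
      ultimately show False using p u(2) by (auto simp: X_def in_keys_iff)
    qed
    then show "single w k * p \<in> X"
      using p w by (simp add: X_def mpoly_ring_mult_closed mpoly_ring_single_closed)
  next
    show "p + q \<in> X" if "p \<in> X" "q \<in> X" for p q
      using that by (simp add: X_def lookup_add mpoly_ring_add_closed)
  qed (auto simp: X_def mem_carrier_mpoly_ring)
  moreover have "S \<subseteq> X"
  proof
    fix f assume f: "f \<in> S"
    have fI: "f \<in> eulerian_ideal V E" using f genideal_mpoly_superset[OF S(1)] gen by blast
    have "lookup f (edge_product T) = 0" if T: "T \<subseteq> A" for T
    proof (rule ccontr)
      assume nz: "lookup f (edge_product T) \<noteq> 0"
      let ?t = "edge_product T"
      have key: "?t \<in> keys f" using nz by (simp add: in_keys_iff)
      then have "card T \<le> 2"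
        using monom_degree_le_mpoly_degree[OF key] S(2)[OF f] by (simp add: monom_degree_edge_product)
      \<comment> \<open>The weight that selects the class of \<open>t\<^sup>T\<close>, which consists of \<open>t\<^sup>T\<close> alone, so that it reads off one coefficient.\<close>
      define g where "g u = (of_bool (parity_equiv (endpoint_monomial ?t) u) :: 'k)" for u
      have "0 = weighted_sum (\<lambda>u. g (endpoint_monomial u)) f"
        by (rule weighted_sum_eulerian_ideal[OF fI, symmetric])
          (auto simp: g_def intro: parity_equiv_sym parity_equiv_trans)
      also have "\<dots> = weighted_sum (\<lambda>u. of_bool (u = ?t)) f"
        unfolding weighted_sum_def
      proof (rule sum.cong)
        fix u assume u: "u \<in> keys f"
        have "f \<in> carrier (mpoly_ring E)" using S(1) f by blast
        then have "keys u \<subseteq> E" "keys ?t \<subseteq> E" using key u by (simp_all add: mem_carrier_mpoly_ring)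
        then have "parity_equiv (endpoint_monomial ?t) (endpoint_monomial u) \<longleftrightarrow> u = ?t"
          using isolated[OF T \<open>card T \<le> 2\<close>, of u] by (auto simp: eulerian_equiv_def parity_equiv_refl)
        then show "lookup f u * g (endpoint_monomial u) = lookup f u * of_bool (u = ?t)"
          by (simp add: g_def)
      qed simp
      also have "\<dots> = lookup f ?t" by (rule weighted_sum_indicator)
      finally show False using nz by simp
    qed
    then show "f \<in> X" using f S(1) by (auto simp: X_def)
  qed
  ultimately have "single (edge_product A) 1 - single (edge_product B) 1 \<in> X"
    using genideal_mpoly_least binomial by blast
  then have "lookup (single (edge_product A) 1 - single (edge_product B) 1 :: ('a set, 'k) mpoly) (edge_product A) = 0"
    by (simp add: X_def)
  moreover have "edge_product B \<noteq> edge_product A"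
  proof
    assume "edge_product B = edge_product A"
    then have "B = A" using keys_edge_product fin by metis
    then show False using disj cards m c(2) by auto
  qed
  ultimately show False by (simp add: lookup_minus lookup_single when_def)
qed


section \<open>Quadratic generation and chordality\<close>

theorem corollary4p7:
  fixes n :: nat and E :: "nat set set"
  assumes "simple_graph {1..n} E"
    and "card E \<ge> 2"
    and "bipartite {1..n} E"
  shows "max_generating_degree E (eulerian_ideal {1..n} E :: (nat set, 'k::field) mpoly set) = 2
     \<longleftrightarrow> bipartite_chordal {1..n} E"
proof -
  let ?I = "eulerian_ideal {1..n} E :: (nat set, 'k) mpoly set"
  have minimal: "\<exists>S. minimal_homogeneous_generators E ?I S \<and> S \<subseteq> eulerian_binomials E N \<and> (\<exists>f\<in>S. f \<noteq> 0)"
    if N: "2 \<le> N" "card E \<le> N \<or> bipartite_chordal {1..n} E" for N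
  proof -
    let ?Q = "eulerian_binomials E N :: (nat set, 'k) mpoly set"
    have "\<And>f. f \<in> ?Q \<Longrightarrow> mpoly_homogeneous f"
      by (rule eulerian_binomial_homogeneous(1)[OF assms(1)])
    then obtain S where S: "S \<subseteq> ?Q" "minimal_homogeneous_generators E (genideal (mpoly_ring E) ?Q) S"
      by (rule exists_minimal_homogeneous_generators[OF finite_eulerian_binomials[OF assms(1)]
            eulerian_binomials_closed[OF assms(1)]])
    note S2 = S(2)[unfolded genideal_eulerian_binomials[OF assms(1) N]]
    have "\<exists>f\<in>S. f \<noteq> 0"
    proof (rule ccontr)
      assume "\<not> (\<exists>f\<in>S. f \<noteq> 0)"
      then have "S \<subseteq> {0}" by blast
      moreover have "ideal {0 :: (nat set, 'k) mpoly} (mpoly_ring E)"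
        by (rule mpoly_idealI) (auto simp: mem_carrier_mpoly_ring)
      ultimately have "genideal (mpoly_ring E) S \<subseteq> {0}" by (metis genideal_mpoly_least)
      moreover have "genideal (mpoly_ring E) S = ?I"
        using S2 unfolding minimal_homogeneous_generators_def by (elim conjE)
      moreover obtain f where "f \<in> ?I" "f \<noteq> 0"
        using eulerian_ideal_nontrivial[OF assms(1,2)] by (elim exE conjE)
      ultimately show False by blast
    qed
    with S(1) S2 show ?thesis by (intro exI conjI)
  qed
  show ?thesis
  proof
    assume chordal: "bipartite_chordal {1..n} E"
    then obtain S f where S: "minimal_homogeneous_generators E ?I S" "S \<subseteq> eulerian_binomials E 2"
      and f: "f \<in> S" "f \<noteq> 0" using minimal[of 2] by blast
    show "max_generating_degree E ?I = 2"
    proof (rule max_generating_degree_eqI[OF S(1) f(1)])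
      show "mpoly_degree f = 2" using eulerian_binomial_degree_2[OF assms(1)] f S(2) by blast
      show "mpoly_degree g \<le> 2" if "g \<in> S" for g
        using eulerian_binomial_homogeneous(2)[OF assms(1)] S(2) that by blast
    qed
  next
    assume deg: "max_generating_degree E ?I = 2"
    obtain S where S: "minimal_homogeneous_generators E ?I S" "S \<subseteq> eulerian_binomials E (card E)" "S \<noteq> {}"
      using minimal[of "card E"] assms(2) by blast
    have "finite S" using finite_subset[OF S(2) finite_eulerian_binomials[OF assms(1)]] .
    define d where "d = Max (mpoly_degree ` S)"
    have "d \<in> mpoly_degree ` S" unfolding d_def using \<open>finite S\<close> S(3) by (intro Max_in) auto
    then obtain f where f: "f \<in> S" "mpoly_degree f = d" by blast
    have le: "mpoly_degree g \<le> d" if "g \<in> S" for g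
      unfolding d_def using \<open>finite S\<close> that by (intro Max_ge) auto
    have "d = 2" using max_generating_degree_eqI[OF S(1) f le] deg by simp
    show "bipartite_chordal {1..n} E"
    proof (rule ccontr)
      assume "\<not> bipartite_chordal {1..n} E"
      then obtain c where c: "is_cycle E c" "4 < length c" "\<nexists>e. is_chord E c e"
        using assms(3) unfolding bipartite_chordal_def by blast
      have "S \<subseteq> carrier (mpoly_ring E)"
        using S(1) unfolding minimal_homogeneous_generators_def by (elim conjE)
      moreover have "genideal (mpoly_ring E) S = ?I"
        using S(1) unfolding minimal_homogeneous_generators_def by (elim conjE)
      ultimately show False
        using chordless_cycle_not_generated_by_quadrics[OF assms(1,3) c, of S] le \<open>d = 2\<close> by simp
    qed
  qed
qed

end
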